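(* Let $(M^n,g)$ be a Riemannian manifold and let $\alpha$ be a symmetric $2$-tensor on $TM$. Let $1\le m\le n$, $x_0\in M$, and let $\xi$ be a (local) lower support at $x_0$ for the subtrace $G_m(\alpha^\sharp)$. Let $(e_1,\dots,e_n)$ be any orthonormal basis of $T_{x_0}M$ of eigenvectors of $\alpha^\sharp(x_0)$ with corresponding eigenvalues $$\lambda_1\le\dots\le\lambda_m=\dots=\lambda_{D_m}<\lambda_{D_m+1}\le\dots\le\lambda_n,$$ and let $V_m=\operatorname{span}\{e_1,\dots,e_m\}$. Then at $x_0$, for every $1\le i\le n$: (1) $\displaystyle \xi_{;i}=\operatorname{tr}_{V_m}\alpha_{;i}=\sum_{k=1}^m\alpha_{kk;i}$; (2) $\displaystyle \xi_{;ii}\le\sum_{k=1}^m\alpha_{kk;ii}-2\sum_{k=1}^m\sum_{r>D_m}\frac{(\alpha_{kr;i})^2}{\lambda_r-\lambda_k}$.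
   Context: $\alpha$ is smooth and $\alpha^\sharp$ is the endomorphism with $g(\alpha^\sharp(X),Y)=\alpha(X,Y)$. For eigenvalues $\lambda_1(x)\le\dots\le\lambda_n(x)$ of $\alpha^\sharp(x)$ (with multiplicity), the subtrace is $G_m=\sum_{k=1}^m\lambda_k$. $D_m$ is the largest index with $\lambda_{D_m}(x_0)=\lambda_m(x_0)$ (possibly $D_m=n$, in which case the sum over $r>D_m$ is empty). A lower support at $x_0$ for a function $G$ is a smooth function $\xi$ defined near $x_0$ with $\xi\le G$ in a neighbourhood of $x_0$ and $\xi(x_0)=G(x_0)$. Semicolons denote components of Levi-Civita covariant derivatives with respect to the basis $(e_i)$: $\alpha_{kl;i}=(\nabla_{e_i}\alpha)(e_k,e_l)$, $\alpha_{kl;ij}$ the components of $\nabla^2\alpha$, and $\xi_{;i},\xi_{;ij}$ the components of $\nabla\xi,\nabla^2\xi$. *)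

theory Defs
  imports "HOL-Analysis.Analysis"
begin

subsection \<open>Smooth maps on open subsets of Euclidean space\<close>

primrec Ck_on :: "nat \<Rightarrow> 'e::euclidean_space set \<Rightarrow> ('e \<Rightarrow> 'b::real_normed_vector) \<Rightarrow> bool" where
  "Ck_on 0 S f \<longleftrightarrow> continuous_on S f"
| "Ck_on (Suc k) S f \<longleftrightarrow>
     (\<forall>x\<in>S. f differentiable (at x)) \<and> (\<forall>v. Ck_on k S (\<lambda>x. frechet_derivative f (at x) v))"

definition smooth_on :: "'e::euclidean_space set \<Rightarrow> ('e \<Rightarrow> 'b::real_normed_vector) \<Rightarrow> bool" where
  "smooth_on S f \<longleftrightarrow> (\<forall>k. Ck_on k S f)"

subsection \<open>Smooth manifolds\<close>

text \<open>A manifold is a Hausdorff second countable type \<^typ>\<open>'p\<close> with an atlas of charts into the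
  Euclidean space \<^typ>\<open>'e\<close>, so its dimension is \<^term>\<open>DIM('e::euclidean_space)\<close>. A chart is a
  pair of its domain and a map which is relevant only on that domain. The atlas need not be
  maximal.\<close>

type_synonym ('p, 'e) chart = "'p set \<times> ('p \<Rightarrow> 'e)"

abbreviation chart_inv :: "('p, 'e) chart \<Rightarrow> 'e \<Rightarrow> 'p" where
  "chart_inv c \<equiv> inv_into (fst c) (snd c)"

definition charts_at :: "('p, 'e) chart set \<Rightarrow> 'p \<Rightarrow> ('p, 'e) chart set" where
  "charts_at A p = {c \<in> A. p \<in> fst c}"

definition smooth_manifold ::
    "('p::{t2_space, second_countable_topology}, 'e::euclidean_space) chart set \<Rightarrow> bool" where
  "smooth_manifold A \<longleftrightarrow>
     (\<Union>c\<in>A. fst c) = UNIV \<and>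
     (\<forall>c\<in>A. open (fst c) \<and> open (snd c ` fst c) \<and>
        homeomorphism (fst c) (snd c ` fst c) (snd c) (chart_inv c)) \<and>
     (\<forall>c\<in>A. \<forall>c'\<in>A. smooth_on (snd c ` (fst c \<inter> fst c')) (snd c' \<circ> chart_inv c))"

definition smooth_function_on ::
    "('p::{t2_space, second_countable_topology}, 'e::euclidean_space) chart set
      \<Rightarrow> 'p set \<Rightarrow> ('p \<Rightarrow> real) \<Rightarrow> bool" where
  "smooth_function_on A W f \<longleftrightarrow> (\<forall>c\<in>A. smooth_on (snd c ` (fst c \<inter> W)) (f \<circ> chart_inv c))"

subsection \<open>Tangent spaces\<close>

text \<open>A tangent vector at \<open>p\<close> is the family of its coordinate vectors in all charts around \<open>p\<close>,
  related by the derivatives of the transition maps (and set to \<open>0\<close> for all other pairs).\<close>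

datatype ('p, 'e) tvec = TVec (tcomp: "('p, 'e) chart \<Rightarrow> 'e")

instantiation tvec :: (type, real_vector) real_vector
begin

definition "0 = TVec (\<lambda>c. 0)"
definition "u + v = TVec (\<lambda>c. tcomp u c + tcomp v c)"
definition "u - v = TVec (\<lambda>c. tcomp u c - tcomp v c)"
definition "- u = TVec (\<lambda>c. - tcomp u c)"
definition "a *\<^sub>R u = TVec (\<lambda>c. a *\<^sub>R tcomp u c)"

instance
  by standard
    (simp_all add: zero_tvec_def plus_tvec_def minus_tvec_def uminus_tvec_def scaleR_tvec_def
      scaleR_add_left scaleR_add_right add.commute add.left_commute)

end

definition transition_deriv ::
    "('p, 'e::euclidean_space) chart \<Rightarrow> ('p, 'e) chart \<Rightarrow> 'p \<Rightarrow> 'e \<Rightarrow> 'e" where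
  "transition_deriv c c' p = frechet_derivative (snd c' \<circ> chart_inv c) (at (snd c p))"

definition tangent_space ::
    "('p, 'e::euclidean_space) chart set \<Rightarrow> 'p \<Rightarrow> ('p, 'e) tvec set" where
  "tangent_space A p = {v.
     (\<forall>c\<in>charts_at A p. \<forall>c'\<in>charts_at A p. tcomp v c' = transition_deriv c c' p (tcomp v c)) \<and>
     (\<forall>c. c \<notin> charts_at A p \<longrightarrow> tcomp v c = 0)}"

text \<open>The tangent vector at \<open>p\<close> whose coordinate vector in the chart \<open>c\<close> is \<open>a\<close>.\<close>

definition coord_vec ::
    "('p, 'e::euclidean_space) chart set \<Rightarrow> ('p, 'e) chart \<Rightarrow> 'p \<Rightarrow> 'e \<Rightarrow> ('p, 'e) tvec" where
  "coord_vec A c p a =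
     TVec (\<lambda>c'. if c' \<in> charts_at A p then transition_deriv c c' p a else 0)"

subsection \<open>Covariant tensor fields\<close>

text \<open>A covariant \<open>k\<close>-tensor field takes a point and a list of \<open>k\<close> tangent vectors there.
  A function is a \<open>0\<close>-tensor field, which ignores its (empty) list.\<close>

type_synonym ('p, 'e) tensor = "'p \<Rightarrow> ('p, 'e) tvec list \<Rightarrow> real"

text \<open>\<open>local_rep A c T\<close> is \<open>T\<close> in the chart \<open>c\<close>, as a tensor field on an open subset of \<^typ>\<open>'e\<close>.\<close>

definition local_rep ::
    "('p, 'e::euclidean_space) chart set \<Rightarrow> ('p, 'e) chart \<Rightarrow> ('p, 'e) tensor
      \<Rightarrow> 'e \<Rightarrow> 'e list \<Rightarrow> real" where
  "local_rep A c T x as = T (chart_inv c x) (map (coord_vec A c (chart_inv c x)) as)"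

definition smooth_tensor_field ::
    "('p::{t2_space, second_countable_topology}, 'e::euclidean_space) chart set
      \<Rightarrow> nat \<Rightarrow> ('p, 'e) tensor \<Rightarrow> bool" where
  "smooth_tensor_field A k T \<longleftrightarrow>
     (\<forall>p vs i u v a. length vs = k \<and> set vs \<subseteq> tangent_space A p \<and> i < k \<and>
        u \<in> tangent_space A p \<and> v \<in> tangent_space A p \<longrightarrow>
        T p (vs[i := a *\<^sub>R u + v]) = a * T p (vs[i := u]) + T p (vs[i := v])) \<and>
     (\<forall>c\<in>A. \<forall>as. length as = k \<longrightarrow> smooth_on (snd c ` fst c) (\<lambda>x. local_rep A c T x as))"

definition symmetric_tensor_field ::
    "('p::{t2_space, second_countable_topology}, 'e::euclidean_space) chart set
      \<Rightarrow> ('p, 'e) tensor \<Rightarrow> bool" where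
  "symmetric_tensor_field A T \<longleftrightarrow> smooth_tensor_field A 2 T \<and>
     (\<forall>p. \<forall>u\<in>tangent_space A p. \<forall>v\<in>tangent_space A p. T p [u, v] = T p [v, u])"

definition riemannian_manifold ::
    "('p::{t2_space, second_countable_topology}, 'e::euclidean_space) chart set
      \<Rightarrow> ('p, 'e) tensor \<Rightarrow> bool" where
  "riemannian_manifold A g \<longleftrightarrow> smooth_manifold A \<and> symmetric_tensor_field A g \<and>
     (\<forall>p. \<forall>v\<in>tangent_space A p. v \<noteq> 0 \<longrightarrow> g p [v, v] > 0)"

subsection \<open>The Levi-Civita covariant derivative\<close>

text \<open>In a chart, a connection is given by \<open>\<Gamma> u v = \<nabla>\<^bsub>u\<^esub> v\<close> for vector fields \<open>v\<close> that are constant in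
  the chart. As such fields commute, vanishing torsion means that \<open>\<Gamma>\<close> is symmetric; the other
  condition is \<open>w (G (u, v)) = G (\<nabla>\<^bsub>w\<^esub> u, v) + G (u, \<nabla>\<^bsub>w\<^esub> v)\<close>, i.e. compatibility with the metric.\<close>

definition levi_civita_coeff ::
    "('e::euclidean_space \<Rightarrow> 'e list \<Rightarrow> real) \<Rightarrow> 'e \<Rightarrow> 'e \<Rightarrow> 'e \<Rightarrow> 'e" where
  "levi_civita_coeff G x = (THE \<Gamma>. bilinear \<Gamma> \<and>
     (\<forall>u v. \<Gamma> u v = \<Gamma> v u) \<and>
     (\<forall>u v w. frechet_derivative (\<lambda>y. G y [u, v]) (at x) w = G x [\<Gamma> w u, v] + G x [u, \<Gamma> w v]))"

text \<open>The differentiation slot is the last one: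
  \<open>(\<nabla>T)(v\<^sub>1, \<dots>, v\<^sub>k, w) = w (T(v\<^sub>1, \<dots>, v\<^sub>k)) - (\<Sum>i. T(v\<^sub>1, \<dots>, \<nabla>\<^bsub>w\<^esub> v\<^sub>i, \<dots>, v\<^sub>k))\<close>
  with \<open>v\<^sub>1, \<dots>, v\<^sub>k\<close> extended to constant fields.\<close>

definition local_nabla ::
    "('e::euclidean_space \<Rightarrow> 'e list \<Rightarrow> real) \<Rightarrow> ('e \<Rightarrow> 'e list \<Rightarrow> real) \<Rightarrow> 'e \<Rightarrow> 'e list \<Rightarrow> real" where
  "local_nabla G T x as = (let vs = butlast as; w = last as in
     frechet_derivative (\<lambda>y. T y vs) (at x) w -
     (\<Sum>i<length vs. T x (vs[i := levi_civita_coeff G x w (vs ! i)])))"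

text \<open>The covariant derivative of \<open>T\<close> on the domain of the chart \<open>c\<close>, computed in \<open>c\<close>. For
  \<open>T = \<alpha>\<close> the component \<open>\<alpha>\<^bsub>kl;i\<^esub>\<close> is \<open>nabla A g c \<alpha> p [e\<^sub>k, e\<^sub>l, e\<^sub>i]\<close> and \<open>\<alpha>\<^bsub>kl;ij\<^esub>\<close> is
  \<open>nabla A g c (nabla A g c \<alpha>) p [e\<^sub>k, e\<^sub>l, e\<^sub>i, e\<^sub>j]\<close>. As the covariant derivative is a tensor, the
  values do not depend on the chart.\<close>

definition nabla ::
    "('p, 'e::euclidean_space) chart set \<Rightarrow> ('p, 'e) tensor \<Rightarrow> ('p, 'e) chart
      \<Rightarrow> ('p, 'e) tensor \<Rightarrow> ('p, 'e) tensor" where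
  "nabla A g c T p vs =
     local_nabla (local_rep A c g) (local_rep A c T) (snd c p) (map (\<lambda>v. tcomp v c) vs)"

subsection \<open>Orthonormal bases, traces and subtraces\<close>

text \<open>Here \<open>h\<close> and \<open>b\<close> are bilinear forms on a subspace \<open>V\<close>, with \<open>h\<close> an inner product;
  families are indexed by \<open>1, \<dots>, d\<close>.\<close>

definition orthonormal_basis ::
    "('v::real_vector list \<Rightarrow> real) \<Rightarrow> 'v set \<Rightarrow> nat \<Rightarrow> (nat \<Rightarrow> 'v) \<Rightarrow> bool" where
  "orthonormal_basis h V d e \<longleftrightarrow> span (e ` {1..d}) = V \<and>
     (\<forall>j\<in>{1..d}. \<forall>k\<in>{1..d}. h [e j, e k] = (if j = k then 1 else 0))"

definition trace_on ::
    "('v::real_vector list \<Rightarrow> real) \<Rightarrow> 'v set \<Rightarrow> ('v list \<Rightarrow> real) \<Rightarrow> real" where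
  "trace_on h V b = (THE t. \<forall>d f. orthonormal_basis h V d f \<longrightarrow> t = (\<Sum>k=1..d. b [f k, f k]))"

definition sharp ::
    "('p, 'e::euclidean_space) chart set \<Rightarrow> ('p, 'e) tensor \<Rightarrow> ('p, 'e) tensor
      \<Rightarrow> 'p \<Rightarrow> ('p, 'e) tvec \<Rightarrow> ('p, 'e) tvec" where
  "sharp A g \<alpha> p u =
     (THE w. w \<in> tangent_space A p \<and> (\<forall>v\<in>tangent_space A p. g p [w, v] = \<alpha> p [u, v]))"

text \<open>The eigenvalues of the endomorphism \<open>F\<close> of \<open>V\<close> in nondecreasing order, each as often as the
  dimension of its eigenspace says.\<close>

definition eigenvalue_list :: "'v::real_vector set \<Rightarrow> ('v \<Rightarrow> 'v) \<Rightarrow> real list" where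
  "eigenvalue_list V F =
     (THE xs. sorted xs \<and> (\<forall>\<mu>. count_list xs \<mu> = dim {v \<in> V. F v = \<mu> *\<^sub>R v}))"

text \<open>\<open>eigenvalue A g \<alpha> p k\<close> is the \<open>k\<close>-th eigenvalue of \<open>\<alpha>\<^sup>\<sharp>\<close> at \<open>p\<close>, counted from \<open>1\<close>.\<close>

definition eigenvalue ::
    "('p, 'e::euclidean_space) chart set \<Rightarrow> ('p, 'e) tensor \<Rightarrow> ('p, 'e) tensor
      \<Rightarrow> 'p \<Rightarrow> nat \<Rightarrow> real" where
  "eigenvalue A g \<alpha> p k = eigenvalue_list (tangent_space A p) (sharp A g \<alpha> p) ! (k - 1)"

definition subtrace ::
    "('p, 'e::euclidean_space) chart set \<Rightarrow> ('p, 'e) tensor \<Rightarrow> ('p, 'e) tensor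
      \<Rightarrow> nat \<Rightarrow> 'p \<Rightarrow> real" where
  "subtrace A g \<alpha> m p = (\<Sum>k=1..m. eigenvalue A g \<alpha> p k)"

definition lower_support ::
    "('p::{t2_space, second_countable_topology}, 'e::euclidean_space) chart set
      \<Rightarrow> ('p \<Rightarrow> real) \<Rightarrow> ('p \<Rightarrow> real) \<Rightarrow> 'p \<Rightarrow> bool" where
  "lower_support A G \<xi> x0 \<longleftrightarrow>
     (\<exists>W. open W \<and> x0 \<in> W \<and> smooth_function_on A W \<xi> \<and> (\<forall>x\<in>W. \<xi> x \<le> G x)) \<and> \<xi> x0 = G x0"

end

theory Submission
  imports Defs
begin

text \<open>
The sum of the lowest \<open>m\<close> eigenvalues is a minimum: it is at most the trace of \<open>\<alpha>\<close> over any \<open>m\<close>-dimensional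
subspace. Hence one can test the support function \<open>\<xi>\<close> by moving the space \<open>V\<^sub>m\<close> away from \<open>x\<^sub>0\<close> along a curve.
The trace over the moving space minus \<open>\<xi>\<close> is nonnegative and vanishes at \<open>x\<^sub>0\<close>, so its first derivative is zero and
its second derivative is nonnegative. The eigenvalues themselves are never differentiated. Moving \<open>V\<^sub>m\<close> by
parallel transport would give the bound with the second covariant derivatives alone; tilting \<open>e\<^sub>k\<close> in addition with
velocity \<open>- \<alpha>\<^bsub>kr;i\<^esub> / (\<lambda>\<^sub>r - \<lambda>\<^sub>k)\<close> towards each \<open>e\<^sub>r\<close> beyond the gap is optimal and produces the quadratic term.

Two devices keep this elementary. First, orthonormal frames along the curve would require solving an equation
for parallel transport, or orthonormalisation. Instead the vectors \<open>e\<^sub>k\<close> move with constant velocity in a chart,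
and \<open>partial_eigenvalue_sum_le\<close> bounds the sum of the lowest eigenvalues by test vectors whose Gram matrix is \<open>1 + h\<close>,
with an error of order \<open>h\<^sup>2\<close>. Second, \<open>\<alpha> - \<lambda>\<^sub>k g\<close> has the same covariant derivatives as \<open>\<alpha>\<close>, and \<open>e\<^sub>k\<close> lies in its
kernel at \<open>x\<^sub>0\<close>. In \<open>second_local_nabla_at_kernel\<close> this removes the derivatives of the Christoffel symbols from
the second covariant derivative.

The argument in a chart is \<open>subtrace_support_in_coordinates\<close>. It uses the simultaneous diagonalisation
\<open>eigenframe_exists\<close> of \<open>g\<close> and \<open>\<alpha>\<close> at nearby points and the existence of the Levi-Civita connection,
\<open>levi_civita_coeff\<close>. The passage to the manifold identifies the subtrace, defined by dimensions of
eigenspaces, with a sum over such a diagonalising frame (\<open>subtrace_eq_eigenframe_sum\<close>), and the trace over \<open>V\<^sub>m\<close> with the sum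
over the given basis (\<open>trace_on_eq_sum\<close>).
\<close>

section \<open>Orthonormal families of bilinear forms\<close>

definition orthonormal_family :: "('v::real_vector \<Rightarrow> 'v \<Rightarrow> real) \<Rightarrow> 'i set \<Rightarrow> ('i \<Rightarrow> 'v) \<Rightarrow> bool" where
  "orthonormal_family H I f \<longleftrightarrow> (\<forall>j\<in>I. \<forall>k\<in>I. H (f j) (f k) = (if j = k then 1 else 0))"

definition inner_form :: "('v::real_vector \<Rightarrow> 'v \<Rightarrow> real) \<Rightarrow> bool" where
  "inner_form H \<longleftrightarrow> bilinear H \<and> (\<forall>u v. H u v = H v u) \<and> (\<forall>v. v \<noteq> 0 \<longrightarrow> H v v > 0)"

lemmas bilinear_simps = bilinear_ladd bilinear_radd bilinear_lsub bilinear_rsub bilinear_lmul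
  bilinear_rmul bilinear_lneg bilinear_rneg bilinear_lzero bilinear_rzero

lemma bilinear_sum_left: "bilinear H \<Longrightarrow> H (\<Sum>j\<in>I. a j *\<^sub>R f j) v = (\<Sum>j\<in>I. a j *\<^sub>R H (f j) v)"
  unfolding bilinear_def
  using linear_sum[of "\<lambda>x. H x v" "\<lambda>j. a j *\<^sub>R f j" I] linear_scale[of "\<lambda>x. H x v"] by simp

lemma bilinear_sum_right: "bilinear H \<Longrightarrow> H v (\<Sum>j\<in>I. a j *\<^sub>R f j) = (\<Sum>j\<in>I. a j *\<^sub>R H v (f j))"
  unfolding bilinear_def by (simp add: linear_sum linear_scale)

lemma orthonormal_family_coeff:
  assumes "bilinear H" "finite I" "orthonormal_family H I f" "k \<in> I"
  shows "H (\<Sum>j\<in>I. a j *\<^sub>R f j) (f k) = a k"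
proof -
  have "H (\<Sum>j\<in>I. a j *\<^sub>R f j) (f k) = (\<Sum>j\<in>I. if k = j then a k else 0)"
    using assms(3,4) by (auto simp: bilinear_sum_left[OF assms(1)] orthonormal_family_def intro!: sum.cong)
  then show ?thesis using assms by simp
qed

lemma orthonormal_expansion:
  assumes "bilinear H" "finite I" "orthonormal_family H I f" "v \<in> span (f ` I)"
  shows "v = (\<Sum>j\<in>I. H v (f j) *\<^sub>R f j)"
  using assms(4)
proof (induction rule: span_induct_alt)
  case base
  show ?case using assms(1) by (simp add: bilinear_simps)
next
  case (step a x y)
  from step(1) obtain k where k: "k \<in> I" "x = f k" by auto
  have "(\<Sum>j\<in>I. H x (f j) *\<^sub>R f j) = (\<Sum>j\<in>I. if k = j then f k else 0)"
    using assms(3) k by (auto simp: orthonormal_family_def intro!: sum.cong)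
  also have "\<dots> = x" using k assms(2) by simp
  finally have x: "(\<Sum>j\<in>I. H x (f j) *\<^sub>R f j) = x" .
  have "(\<Sum>j\<in>I. H (a *\<^sub>R x + y) (f j) *\<^sub>R f j)
      = (\<Sum>j\<in>I. a *\<^sub>R (H x (f j) *\<^sub>R f j) + H y (f j) *\<^sub>R f j)"
    by (simp add: bilinear_simps[OF assms(1)] algebra_simps)
  also have "\<dots> = a *\<^sub>R (\<Sum>j\<in>I. H x (f j) *\<^sub>R f j) + (\<Sum>j\<in>I. H y (f j) *\<^sub>R f j)"
    by (simp only: sum.distrib scaleR_sum_right)
  also have "\<dots> = a *\<^sub>R x + y"
    unfolding x using step by simp
  finally show ?case by simp
qed

lemma orthonormal_family_inj:
  "orthonormal_family H I f \<Longrightarrow> inj_on f I"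
  unfolding orthonormal_family_def inj_on_def by (metis zero_neq_one)

lemma orthonormal_family_independent:
  assumes "bilinear H" "finite I" "orthonormal_family H I f"
  shows "independent (f ` I)"
proof -
  have "u v = 0" if u: "(\<Sum>v\<in>f ` I. u v *\<^sub>R v) = 0" and v: "v \<in> f ` I" for u v
  proof -
    obtain k where k: "k \<in> I" "v = f k" using v by auto
    have "(\<Sum>j\<in>I. u (f j) *\<^sub>R f j) = 0"
      using u sum.reindex[OF orthonormal_family_inj[OF assms(3)], of "\<lambda>v. u v *\<^sub>R v"] by simp
    then have "H (\<Sum>j\<in>I. u (f j) *\<^sub>R f j) (f k) = 0"
      using assms(1) by (simp add: bilinear_simps)
    then show ?thesis using orthonormal_family_coeff[OF assms, of k "\<lambda>j. u (f j)"] k by simp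
  qed
  then show ?thesis using assms(2) by (subst dependent_finite) auto
qed

lemma orthonormal_family_span:
  fixes f :: "nat \<Rightarrow> 'e::euclidean_space"
  assumes "bilinear H" "orthonormal_family H {1..DIM('e)} f"
  shows "span (f ` {1..DIM('e)}) = UNIV"
proof -
  have "card (f ` {1..DIM('e)}) = DIM('e)"
    using orthonormal_family_inj[OF assms(2)] by (simp add: card_image)
  then show ?thesis
    using card_ge_dim_independent[of "f ` {1..DIM('e)}" UNIV] assms
      orthonormal_family_independent[of H "{1..DIM('e)}" f] by auto
qed

lemma orthonormal_parseval:
  assumes "bilinear H" "finite I" "orthonormal_family H I f" "u \<in> span (f ` I)"
  shows "H u v = (\<Sum>j\<in>I. H u (f j) * H (f j) v)"
proof -
  have "H u v = H (\<Sum>j\<in>I. H u (f j) *\<^sub>R f j) v"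
    using orthonormal_expansion[OF assms] by (rule arg_cong)
  then show ?thesis by (simp add: bilinear_sum_left[OF assms(1)])
qed

text \<open>The change of basis from \<open>e\<close> to \<open>f\<close> has orthonormal columns: by Parseval over \<open>f\<close>, summing the products
of two coefficients over all \<open>f k\<close> gives back \<open>H (e j) (e l)\<close>. The index sets may a priori have
different sizes, as the definition of the trace quantifies over bases of any length.\<close>

lemma sum_diagonal_orthonormal_basis:
  assumes H: "bilinear H" "\<And>u v. H u v = H v u" and b: "bilinear b"
    and I: "finite I" "orthonormal_family H I f" and J: "finite J" "orthonormal_family H J e"
    and span: "span (f ` I) = span (e ` J)"
  shows "(\<Sum>k\<in>I. b (f k) (f k)) = (\<Sum>k\<in>J. b (e k) (e k) :: real)"
proof -
  have fk: "f k = (\<Sum>j\<in>J. H (f k) (e j) *\<^sub>R e j)" if "k \<in> I" for k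
    by (rule orthonormal_expansion[OF H(1) J]) (use span that in \<open>auto intro: span_base\<close>)
  have "b (f k) (f k) = (\<Sum>j\<in>J. \<Sum>l\<in>J. H (f k) (e j) * H (f k) (e l) * b (e l) (e j))" if "k \<in> I" for k
  proof -
    have "b v v = (\<Sum>j\<in>J. \<Sum>l\<in>J. a j * a l * b (e l) (e j))"
      if "v = (\<Sum>j\<in>J. a j *\<^sub>R e j)" for v and a :: "_ \<Rightarrow> real"
      by (simp add: that bilinear_sum_left[OF b] bilinear_sum_right[OF b] sum_distrib_left mult.assoc)
    from this[OF fk[OF that]] show ?thesis .
  qed
  then have "(\<Sum>k\<in>I. b (f k) (f k)) =
      (\<Sum>k\<in>I. \<Sum>j\<in>J. \<Sum>l\<in>J. H (f k) (e j) * H (f k) (e l) * b (e l) (e j))"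
    by simp
  also have "\<dots> = (\<Sum>j\<in>J. \<Sum>l\<in>J. (\<Sum>k\<in>I. H (f k) (e j) * H (f k) (e l)) * b (e l) (e j))"
    by (subst sum.swap) (simp only: sum_distrib_right, intro sum.cong refl sum.swap)
  also have "\<dots> = (\<Sum>j\<in>J. \<Sum>l\<in>J. H (e j) (e l) * b (e l) (e j))"
  proof (intro sum.cong refl)
    fix j l assume jl: "j \<in> J" "l \<in> J"
    have "e j \<in> span (f ` I)" using span jl by (auto intro: span_base)
    from orthonormal_parseval[OF H(1) I this, of "e l"]
    show "(\<Sum>k\<in>I. H (f k) (e j) * H (f k) (e l)) * b (e l) (e j) = H (e j) (e l) * b (e l) (e j)"
      by (simp add: H(2))
  qed
  also have "\<dots> = (\<Sum>j\<in>J. \<Sum>l\<in>J. if j = l then b (e j) (e j) else 0)"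
    using J(2) by (intro sum.cong refl) (auto simp: orthonormal_family_def)
  also have "\<dots> = (\<Sum>k\<in>J. b (e k) (e k))" using J(1) by simp
  finally show ?thesis .
qed

section \<open>Simultaneous diagonalisation of two quadratic forms\<close>

definition eigenframe :: "('v::real_vector \<Rightarrow> 'v \<Rightarrow> real) \<Rightarrow> ('v \<Rightarrow> 'v \<Rightarrow> real) \<Rightarrow> nat
    \<Rightarrow> (nat \<Rightarrow> 'v) \<Rightarrow> (nat \<Rightarrow> real) \<Rightarrow> bool" where
  "eigenframe H B n f \<mu> \<longleftrightarrow> orthonormal_family H {1..n} f \<and>
     (\<forall>j\<in>{1..n}. \<forall>v. B (f j) v = \<mu> j * H (f j) v) \<and> mono_on {1..n} \<mu>"

text \<open>The constant is the minimum of \<open>H v v\<close> on the compact unit sphere.\<close>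

lemma inner_form_coercive:
  fixes H :: "'e::euclidean_space \<Rightarrow> 'e \<Rightarrow> real"
  assumes "inner_form H"
  obtains \<kappa> where "\<kappa> > 0" "\<And>v. \<kappa> * (norm v)\<^sup>2 \<le> H v v"
proof -
  have bb: "bounded_bilinear H"
    using assms by (simp add: inner_form_def bilinear_conv_bounded_bilinear)
  have cont: "continuous_on UNIV (\<lambda>v. H v v)"
    by (intro bounded_bilinear.continuous_on[OF bb] continuous_intros)
  obtain b :: 'e where b: "b \<in> Basis" using nonempty_Basis by blast
  have "sphere (0::'e) 1 \<noteq> {}" using b by (auto intro!: exI[of _ b])
  then obtain s where s: "s \<in> sphere 0 1" "\<And>v. v \<in> sphere 0 1 \<Longrightarrow> H s s \<le> H v v"
    using continuous_attains_inf[OF compact_sphere _ continuous_on_subset[OF cont]] by blast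
  have "s \<noteq> 0" using s by auto
  then have "H s s > 0" using assms by (simp add: inner_form_def)
  moreover have "H s s * (norm v)\<^sup>2 \<le> H v v" for v
  proof (cases "v = 0")
    case True
    then show ?thesis using assms by (simp add: inner_form_def bilinear_simps)
  next
    case False
    define w where "w = (1 / norm v) *\<^sub>R v"
    have v: "norm v *\<^sub>R w = v" using False by (simp add: w_def)
    have "H (norm v *\<^sub>R w) (norm v *\<^sub>R w) = (norm v)\<^sup>2 * H w w"
      using assms by (simp add: inner_form_def bilinear_simps power2_eq_square)
    then have "H v v = (norm v)\<^sup>2 * H w w" unfolding v .
    moreover have "H s s \<le> H w w" using False by (intro s) (simp add: w_def)
    ultimately show ?thesis by (simp add: mult.commute mult_right_mono)
  qed
  ultimately show ?thesis using that by blast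
qed

lemma quadratic_minimum:
  fixes a b :: real
  assumes "\<And>t. 2 * t * a + t\<^sup>2 * b \<ge> 0"
  shows "a = 0"
proof (rule ccontr)
  assume a: "a \<noteq> 0"
  define d where "d = \<bar>b\<bar> + 1"
  have d: "d > 0" "b < d" "d\<^sup>2 > 0" by (auto simp: d_def)
  have "2 * (- a / d) * a + (- a / d)\<^sup>2 * b = a\<^sup>2 * (b - 2 * d) / d\<^sup>2"
    using d by (simp add: field_simps power2_eq_square)
  also have "\<dots> < 0"
    using a d by (intro divide_neg_pos mult_pos_neg) auto
  finally show False using assms[of "- a / d"] by linarith
qed

text \<open>The new vector minimises \<open>B v v\<close> among the \<open>H\<close>-unit vectors that are \<open>H\<close>-orthogonal to the
eigenvectors found so far. The first variation gives the eigenvalue equation against orthogonal \<open>v\<close>, and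
against the old eigenvectors both sides vanish. The minimality in the last conclusion is what makes
successive eigenvalues nondecreasing.\<close>

lemma constrained_minimum_is_eigenvector:
  fixes H B :: "'e::euclidean_space \<Rightarrow> 'e \<Rightarrow> real"
  assumes H: "inner_form H" and B: "bilinear B" "\<And>u v. B u v = B v u" and "finite I"
    and f: "orthonormal_family H I f" "\<And>j v. j \<in> I \<Longrightarrow> B (f j) v = \<mu> j * H (f j) v"
    and nsp: "span (f ` I) \<noteq> UNIV"
  obtains s where "H s s = 1" "\<And>j. j \<in> I \<Longrightarrow> H (f j) s = 0" "\<And>v. B s v = B s s * H s v"
    "\<And>v. (\<And>j. j \<in> I \<Longrightarrow> H (f j) v = 0) \<Longrightarrow> B s s * H v v \<le> B v v"
proof -
  have bil: "bilinear H" and sym: "\<And>u v. H u v = H v u" and pos: "\<And>v. v \<noteq> 0 \<Longrightarrow> H v v > 0"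
    using H by (auto simp: inner_form_def)
  note [simp] = bilinear_simps[OF bil] bilinear_simps[OF B(1)]
  have bbH: "bounded_bilinear H" and bbB: "bounded_bilinear B"
    using bil B by (simp_all add: bilinear_conv_bounded_bilinear)
  define K where "K = {v. H v v = 1 \<and> (\<forall>j\<in>I. H (f j) v = 0)}"
  have proj: "\<forall>j\<in>I. H (f j) (v - (\<Sum>j\<in>I. H v (f j) *\<^sub>R f j)) = 0" for v
    using orthonormal_family_coeff[OF bil \<open>finite I\<close> f(1), of _ "\<lambda>j. H v (f j)"]
    by (simp add: sym[of "f _"])
  have unit: "\<exists>r>0. (1/r) *\<^sub>R v \<in> K \<and> H v v = r\<^sup>2"
    if "v \<noteq> 0" "\<And>j. j \<in> I \<Longrightarrow> H (f j) v = 0" for v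
  proof (intro exI conjI)
    have p: "H v v > 0" using that pos by simp
    then show "sqrt (H v v) > 0" "H v v = (sqrt (H v v))\<^sup>2" by simp_all
    show "(1 / sqrt (H v v)) *\<^sub>R v \<in> K"
      unfolding K_def using that p by (auto simp: field_simps)
  qed
  have clH: "continuous_on UNIV (\<lambda>v. H v v)" "\<And>a. continuous_on UNIV (\<lambda>v. H a v)"
    and clB: "continuous_on UNIV (\<lambda>v. B v v)"
    by (intro bounded_bilinear.continuous_on[OF bbH] bounded_bilinear.continuous_on[OF bbB] continuous_intros)+
  have "closed K"
  proof -
    have "K = {v. H v v = 1} \<inter> (\<Inter>j\<in>I. {v. H (f j) v = 0})" by (auto simp: K_def)
    then show ?thesis
      by (simp add: closed_Int closed_INT closed_Collect_eq clH)
  qed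
  moreover have "bounded K"
  proof -
    obtain \<kappa> where k: "\<kappa> > 0" "\<And>v. \<kappa> * (norm v)\<^sup>2 \<le> H v v" using inner_form_coercive[OF H] by blast
    have "norm v \<le> sqrt (1/\<kappa>)" if "v \<in> K" for v
      using k(2)[of v] that k(1) by (intro real_le_rsqrt) (simp add: K_def field_simps)
    then show ?thesis by (auto simp: bounded_iff)
  qed
  ultimately have "compact K" by (simp add: compact_eq_bounded_closed)
  moreover have "K \<noteq> {}"
  proof -
    obtain v where v: "v \<notin> span (f ` I)" using nsp by auto
    have "(\<Sum>j\<in>I. H v (f j) *\<^sub>R f j) \<in> span (f ` I)"
      by (intro span_sum span_scale span_base) auto
    then have "v - (\<Sum>j\<in>I. H v (f j) *\<^sub>R f j) \<noteq> 0" using v by auto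
    from unit[OF this] proj show ?thesis by blast
  qed
  ultimately obtain s where s: "s \<in> K" "\<And>v. v \<in> K \<Longrightarrow> B s s \<le> B v v"
    using continuous_attains_inf[of K "\<lambda>v. B v v"] continuous_on_subset[OF clB subset_UNIV] by auto
  have min: "B s s * H v v \<le> B v v" if o: "\<And>j. j \<in> I \<Longrightarrow> H (f j) v = 0" for v
  proof (cases "v = 0")
    case True then show ?thesis by simp
  next
    case False
    obtain r where r: "r > 0" "(1/r) *\<^sub>R v \<in> K" "H v v = r\<^sup>2" using unit[OF False o] by blast
    have "B s s \<le> B v v / r\<^sup>2" using s(2)[OF r(2)] r(1) by (simp add: power2_eq_square field_simps)
    then show ?thesis using r by (simp add: field_simps)
  qed
  have sK: "H s s = 1" "\<And>j. j \<in> I \<Longrightarrow> H (f j) s = 0" using s by (auto simp: K_def)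
  have orth: "B s v = B s s * H s v" if o: "\<And>j. j \<in> I \<Longrightarrow> H (f j) v = 0" for v
  proof -
    (* compare s with its competitor s + t v *)
    have "2 * t * (B s v - B s s * H s v) + t\<^sup>2 * (B v v - B s s * H v v) \<ge> 0" for t
      using min[of "s + t *\<^sub>R v"] o sK sym[of v s] B(2)[of v s]
      by (simp add: algebra_simps power2_eq_square)
    from quadratic_minimum[OF this] show ?thesis by simp
  qed
  have "B s v = B s s * H s v" for v
  proof -
    have z: "B s (f j) = 0" "H s (f j) = 0" if "j \<in> I" for j
      using f(2)[OF that, of s] sK(2)[OF that] B(2)[of s] sym[of s] by simp_all
    define p where "p = (\<Sum>j\<in>I. H v (f j) *\<^sub>R f j)"
    have "B s p = 0" "H s p = 0"
      unfolding p_def by (simp_all add: bilinear_sum_right[OF B(1)] bilinear_sum_right[OF bil] z)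
    moreover have "B s (v - p) = B s s * H s (v - p)"
      using proj unfolding p_def by (intro orth) blast
    ultimately show ?thesis by simp
  qed
  then show ?thesis using that[of s] sK min by blast
qed

text \<open>Successive minimisation: the induction keeps the bound \<open>\<mu> j * H v v \<le> B v v\<close> on the orthogonal complement, so
that the next eigenvalue, attained there, is at least all earlier ones.\<close>

lemma eigenframe_exists:
  fixes H B :: "'e::euclidean_space \<Rightarrow> 'e \<Rightarrow> real"
  assumes H: "inner_form H" and B: "bilinear B" "\<And>u v. B u v = B v u"
  obtains f \<mu> where "eigenframe H B DIM('e) f \<mu>"
proof -
  have bil: "bilinear H" and sym: "\<And>u v. H u v = H v u"
    using H by (auto simp: inner_form_def)
  have "\<exists>f \<mu>. eigenframe H B k f \<mu> \<and>
      (\<forall>v. (\<forall>j\<in>{1..k}. H (f j) v = 0) \<longrightarrow> (\<forall>j\<in>{1..k}. \<mu> j * H v v \<le> B v v))"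
    if "k \<le> DIM('e)" for k
    using that
  proof (induction k)
    case 0
    show ?case by (simp add: eigenframe_def orthonormal_family_def mono_on_def)
  next
    case (Suc k)
    then obtain f \<mu> where ef: "eigenframe H B k f \<mu>"
      and low: "\<And>v j. (\<forall>j\<in>{1..k}. H (f j) v = 0) \<Longrightarrow> j\<in>{1..k} \<Longrightarrow> \<mu> j * H v v \<le> B v v"
      by fastforce
    have on: "orthonormal_family H {1..k} f" using ef by (simp add: eigenframe_def)
    have "dim (span (f ` {1..k})) \<le> k"
      by (metis card_atLeastAtMost card_image_le diff_Suc_1 dim_le_card dim_span finite_atLeastAtMost finite_imageI le_trans span_superset)
    then have nsp: "span (f ` {1..k}) \<noteq> UNIV" using Suc.prems by (metis dim_UNIV not_less_eq_eq)
    have eig: "B (f j) v = \<mu> j * H (f j) v" if "j \<in> {1..k}" for j v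
      using ef that by (simp add: eigenframe_def)
    obtain s where s: "H s s = 1" "\<And>j. j \<in> {1..k} \<Longrightarrow> H (f j) s = 0"
      "\<And>v. B s v = B s s * H s v"
      "\<And>v. (\<And>j. j \<in> {1..k} \<Longrightarrow> H (f j) v = 0) \<Longrightarrow> B s s * H v v \<le> B v v"
      by (rule constrained_minimum_is_eigenvector[OF H B finite_atLeastAtMost on eig nsp]) blast+
    define f' where "f' = f(Suc k := s)"
    define \<mu>' where "\<mu>' = \<mu>(Suc k := B s s)"
    have I: "{1..Suc k} = insert (Suc k) {1..k}" by auto
    have old: "f' j = f j" "\<mu>' j = \<mu> j" if "j \<in> {1..k}" for j
      using that by (auto simp: f'_def \<mu>'_def)
    have new: "f' (Suc k) = s" "\<mu>' (Suc k) = B s s" by (auto simp: f'_def \<mu>'_def)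
    have s2: "H s (f j) = 0" if "j \<in> {1..k}" for j
      using s(2)[OF that] sym[of s "f j"] by simp
    have "orthonormal_family H {1..Suc k} f'"
      using on s(1,2) s2 unfolding orthonormal_family_def I
      by (auto simp: old new)
    moreover have "\<forall>j\<in>{1..Suc k}. \<forall>v. B (f' j) v = \<mu>' j * H (f' j) v"
    proof (intro ballI allI)
      fix j v assume "j \<in> {1..Suc k}"
      then consider "j = Suc k" | "j \<in> {1..k}" unfolding I by blast
      then show "B (f' j) v = \<mu>' j * H (f' j) v"
        by cases (simp_all only: old new eig s(3)[of v])
    qed
    moreover have "mono_on {1..Suc k} \<mu>'"
    proof (rule mono_onI)
      fix i j assume ij: "i \<in> {1..Suc k}" "j \<in> {1..Suc k}" "i \<le> j"
      have "\<mu> l \<le> B s s" if "l \<in> {1..k}" for l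
        using low[of s l] s(1,2) that by simp
      then show "\<mu>' i \<le> \<mu>' j"
        using ij ef unfolding eigenframe_def mono_on_def I \<mu>'_def by auto
    qed
    moreover have "\<forall>v. (\<forall>j\<in>{1..Suc k}. H (f' j) v = 0) \<longrightarrow> (\<forall>j\<in>{1..Suc k}. \<mu>' j * H v v \<le> B v v)"
    proof (intro allI impI ballI)
      fix v j assume o: "\<forall>j\<in>{1..Suc k}. H (f' j) v = 0" and "j \<in> {1..Suc k}"
      then consider "j = Suc k" | "j \<in> {1..k}" unfolding I by blast
      moreover have o': "\<forall>j\<in>{1..k}. H (f j) v = 0" using o unfolding I by (auto simp: old)
      ultimately show "\<mu>' j * H v v \<le> B v v"
        by cases (use o' s(4)[of v] low[of v] in \<open>auto simp: old new\<close>)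
    qed
    ultimately show ?case unfolding eigenframe_def by blast
  qed
  from this[of "DIM('e)"] that show ?thesis by blast
qed

section \<open>A variational bound for partial sums of eigenvalues\<close>

text \<open>A variational bound for the sum of the lowest \<open>m\<close> eigenvalues by arbitrary test vectors \<open>w\<close>, which need
not be orthonormal; \<open>h\<close> is the deviation of their Gram matrix from the identity. Instead of inverting the
Gram matrix \<open>1 + h\<close>, it contracts \<open>B\<close> with the linearisation \<open>1 - h\<close> of the inverse, which costs an
error of second order in \<open>h\<close>.

The contraction equals \<open>\<Sum>j. \<mu> j * q j\<close> for weights with \<open>0 \<le> q j \<le> 1\<close> and total weight \<open>m - \<Sum>k l. (h k l)\<^sup>2\<close>.
Moving all the weight to the first \<open>m\<close> indices can only decrease the sum, up to \<open>\<mu> m\<close> times the missing weight.\<close>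

lemma partial_eigenvalue_sum_le:
  fixes H B :: "'e::euclidean_space \<Rightarrow> 'e \<Rightarrow> real" and w :: "nat \<Rightarrow> 'e" and f :: "nat \<Rightarrow> 'e"
  assumes H: "inner_form H" and B: "bilinear B"
    and ef: "eigenframe H B DIM('e) f \<mu>" and m: "1 \<le> m" "m \<le> DIM('e)"
    and h: "\<And>k l. h k l = H (w k) (w l) - (if k = l then 1 else 0)"
    and small: "\<And>k l. k \<in> {1..m} \<Longrightarrow> l \<in> {1..m} \<Longrightarrow> \<bar>h k l\<bar> \<le> 1 / m"
    and K: "\<mu> m \<le> K"
  shows "(\<Sum>j=1..m. \<mu> j) \<le> (\<Sum>k=1..m. B (w k) (w k))
     - (\<Sum>k=1..m. \<Sum>l=1..m. h k l * B (w k) (w l)) + K * (\<Sum>k=1..m. \<Sum>l=1..m. (h k l)\<^sup>2)"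
proof -
  let ?I = "{1..m}" and ?J = "{1..DIM('e)}"
  have bil: "bilinear H" and sym: "\<And>u v. H u v = H v u" and pos: "\<And>v. v \<noteq> 0 \<Longrightarrow> H v v > 0"
    using H by (auto simp: inner_form_def)
  have on: "orthonormal_family H ?J f" and eig: "\<And>j v. j \<in> ?J \<Longrightarrow> B (f j) v = \<mu> j * H (f j) v"
    and mono: "mono_on ?J \<mu>"
    using ef by (auto simp: eigenframe_def)
  have span: "v \<in> span (f ` ?J)" for v
    using orthonormal_family_span[OF bil on] by simp
  define a where "a k j = H (w k) (f j)" for k j
  have g: "H (w k) (w l) = (\<Sum>j\<in>?J. a k j * a l j)" for k l
    using orthonormal_parseval[OF bil _ on span, of "w k" "w l"] by (simp add: a_def sym)
  have b: "B (w k) (w l) = (\<Sum>j\<in>?J. \<mu> j * (a k j * a l j))" for k l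
  proof -
    have "B (w k) (w l) = B (\<Sum>j\<in>?J. H (w k) (f j) *\<^sub>R f j) (w l)"
      using orthonormal_expansion[OF bil _ on span, of "w k"] by simp
    also have "\<dots> = (\<Sum>j\<in>?J. H (w k) (f j) * (\<mu> j * H (f j) (w l)))"
      using eig by (simp add: bilinear_sum_left[OF B])
    finally show ?thesis by (simp add: a_def sym mult_ac)
  qed
  (* q j is the diagonal entry of 2 P - P^2 at f j, where P v = (sum over k of H v (w k) times w k) *)
  define q where "q j = (\<Sum>k\<in>?I. (a k j)\<^sup>2) - (\<Sum>k\<in>?I. \<Sum>l\<in>?I. h k l * (a k j * a l j))" for j
  have sum_mult_q: "(\<Sum>j\<in>?J. c j * q j) = (\<Sum>k\<in>?I. \<Sum>j\<in>?J. c j * (a k j * a k j))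
      - (\<Sum>k\<in>?I. \<Sum>l\<in>?I. h k l * (\<Sum>j\<in>?J. c j * (a k j * a l j)))" for c :: "nat \<Rightarrow> real"
  proof -
    have "(\<Sum>j\<in>?J. c j * q j) = (\<Sum>j\<in>?J. \<Sum>k\<in>?I. c j * (a k j * a k j))
        - (\<Sum>j\<in>?J. \<Sum>k\<in>?I. \<Sum>l\<in>?I. h k l * (c j * (a k j * a l j)))"
      unfolding q_def right_diff_distrib sum_subtractf sum_distrib_left
      by (simp add: power2_eq_square mult_ac)
    also have "(\<Sum>j\<in>?J. \<Sum>k\<in>?I. c j * (a k j * a k j)) = (\<Sum>k\<in>?I. \<Sum>j\<in>?J. c j * (a k j * a k j))"
      by (rule sum.swap)
    also have "(\<Sum>j\<in>?J. \<Sum>k\<in>?I. \<Sum>l\<in>?I. h k l * (c j * (a k j * a l j)))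
      = (\<Sum>k\<in>?I. \<Sum>l\<in>?I. h k l * (\<Sum>j\<in>?J. c j * (a k j * a l j)))"
      by (subst sum.swap) (simp only: sum_distrib_left, intro sum.cong refl sum.swap)
    finally show ?thesis .
  qed
  have q_sum: "(\<Sum>j\<in>?J. q j) = m - (\<Sum>k\<in>?I. \<Sum>l\<in>?I. (h k l)\<^sup>2)"
  proof -
    have "(\<Sum>j\<in>?J. q j) = (\<Sum>k\<in>?I. H (w k) (w k)) - (\<Sum>k\<in>?I. \<Sum>l\<in>?I. h k l * H (w k) (w l))"
      using sum_mult_q[of "\<lambda>_. 1"] by (simp add: g)
    also have "(\<Sum>k\<in>?I. \<Sum>l\<in>?I. h k l * H (w k) (w l))
        = (\<Sum>k\<in>?I. \<Sum>l\<in>?I. (h k l)\<^sup>2 + (if k = l then h k k else 0))"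
      by (intro sum.cong refl) (simp add: h algebra_simps power2_eq_square)
    also have "\<dots> = (\<Sum>k\<in>?I. \<Sum>l\<in>?I. (h k l)\<^sup>2) + (\<Sum>k\<in>?I. h k k)"
      by (simp add: sum.distrib)
    also have "(\<Sum>k\<in>?I. H (w k) (w k)) = m + (\<Sum>k\<in>?I. h k k)"
      by (simp add: h sum_subtractf)
    finally show ?thesis by simp
  qed
  (* 1 - q j is the squared H-length of f j - P (f j) *)
  have q_le: "q j \<le> 1" if "j \<in> ?J" for j
  proof -
    define p where "p = (\<Sum>k\<in>?I. a k j *\<^sub>R w k)"
    define z where "z = f j - p"
    have hh: "(\<Sum>k\<in>?I. \<Sum>l\<in>?I. a k j * (a l j * H (w k) (w l)))
      = (\<Sum>k\<in>?I. (a k j)\<^sup>2) + (\<Sum>k\<in>?I. \<Sum>l\<in>?I. h k l * (a k j * a l j))"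
    proof -
      have "(\<Sum>k\<in>?I. \<Sum>l\<in>?I. a k j * (a l j * H (w k) (w l)))
        = (\<Sum>k\<in>?I. \<Sum>l\<in>?I. (if k = l then (a k j)\<^sup>2 else 0) + h k l * (a k j * a l j))"
        by (intro sum.cong refl) (simp add: h algebra_simps power2_eq_square)
      then show ?thesis by (simp add: sum.distrib)
    qed
    have "H z z = 1 - 2 * (\<Sum>k\<in>?I. (a k j)\<^sup>2) + (\<Sum>k\<in>?I. \<Sum>l\<in>?I. a k j * (a l j * H (w k) (w l)))"
    proof -
      have "H (f j) (f j) = 1" using on that by (simp add: orthonormal_family_def)
      moreover have "H (f j) p = (\<Sum>k\<in>?I. (a k j)\<^sup>2)"
        by (simp add: p_def bilinear_sum_right[OF bil] a_def sym[of "f j"] power2_eq_square)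
      moreover have "H p p
          = (\<Sum>k\<in>?I. \<Sum>l\<in>?I. a k j * (a l j * H (w k) (w l)))"
        unfolding p_def
        by (subst bilinear_sum_left[OF bil]) (simp add: bilinear_sum_right[OF bil] sum_distrib_left)
      ultimately show ?thesis
        by (simp add: z_def bilinear_simps[OF bil] sym[of p "f j"])
    qed
    also have "\<dots> = 1 - q j" unfolding hh q_def by simp
    finally show ?thesis
      using pos[of z] by (cases "z = 0") (auto simp: bilinear_simps[OF bil])
  qed
  (* the bound 1 / m on the entries of h enters only here: it makes the norm of h at most 1 *)
  have q_ge: "0 \<le> q j" for j
  proof -
    have "(\<Sum>k\<in>?I. \<Sum>l\<in>?I. h k l * (a k j * a l j)) \<le> (\<Sum>k\<in>?I. \<Sum>l\<in>?I. (1/m) * ((a k j)\<^sup>2 / 2 + (a l j)\<^sup>2 / 2))"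
    proof (intro sum_mono)
      fix k l assume "k \<in> ?I" "l \<in> ?I"
      have "h k l * (a k j * a l j) \<le> \<bar>h k l\<bar> * \<bar>a k j * a l j\<bar>" by (metis abs_ge_self abs_mult)
      also have "\<dots> \<le> (1/m) * ((a k j)\<^sup>2 / 2 + (a l j)\<^sup>2 / 2)"
      proof (intro mult_mono)
        have "0 \<le> (\<bar>a k j\<bar> - \<bar>a l j\<bar>)\<^sup>2" by simp
        then show "\<bar>a k j * a l j\<bar> \<le> (a k j)\<^sup>2 / 2 + (a l j)\<^sup>2 / 2"
          by (simp add: power2_diff abs_mult)
      qed (use small[OF \<open>k \<in> ?I\<close> \<open>l \<in> ?I\<close>] in auto)
      finally show "h k l * (a k j * a l j) \<le> (1/m) * ((a k j)\<^sup>2 / 2 + (a l j)\<^sup>2 / 2)" .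
    qed
    also have "\<dots> = (\<Sum>k\<in>?I. (a k j)\<^sup>2)"
      using m(1) by (simp add: sum.distrib sum_distrib_left[symmetric] sum_divide_distrib[symmetric] algebra_simps add_divide_distrib)
    finally show ?thesis by (simp add: q_def)
  qed
  define ind :: "nat \<Rightarrow> real" where "ind j = (if j \<le> m then 1 else 0)" for j
  have chi: "(\<Sum>j\<in>?J. c j * ind j) = (\<Sum>j\<in>?I. c j)" for c :: "nat \<Rightarrow> real"
  proof -
    have "(\<Sum>j\<in>?J. c j * ind j) = (\<Sum>j\<in>?I. c j * ind j)"
      using m by (intro sum.mono_neutral_right) (auto simp: ind_def)
    then show ?thesis by (simp add: ind_def)
  qed
  (* both factors change sign at j = m *)
  have "0 \<le> (\<Sum>j\<in>?J. (\<mu> j - \<mu> m) * (q j - ind j))"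
  proof (rule sum_nonneg)
    fix j assume j: "j \<in> ?J"
    show "0 \<le> (\<mu> j - \<mu> m) * (q j - ind j)"
    proof (cases "j \<le> m")
      case True
      then have "\<mu> j \<le> \<mu> m" using mono j m by (auto simp: mono_on_def)
      then show ?thesis using q_le[OF j] True by (simp add: ind_def mult_nonpos_nonpos)
    next
      case False
      then have "\<mu> m \<le> \<mu> j" using mono j m by (auto simp: mono_on_def)
      then show ?thesis using q_ge[of j] False by (simp add: ind_def)
    qed
  qed
  also have "\<dots> = (\<Sum>j\<in>?J. \<mu> j * q j) - (\<Sum>j\<in>?I. \<mu> j) + \<mu> m * (m - (\<Sum>j\<in>?J. q j))"
    using chi[of \<mu>] chi[of "\<lambda>_. 1"]
    by (simp add: algebra_simps sum.distrib sum_subtractf sum_distrib_left[symmetric] sum_distrib_right[symmetric])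
  finally have "(\<Sum>j\<in>?I. \<mu> j) \<le> (\<Sum>j\<in>?J. \<mu> j * q j) + \<mu> m * (\<Sum>k\<in>?I. \<Sum>l\<in>?I. (h k l)\<^sup>2)"
    unfolding q_sum by simp
  also have "\<dots> \<le> (\<Sum>j\<in>?J. \<mu> j * q j) + K * (\<Sum>k\<in>?I. \<Sum>l\<in>?I. (h k l)\<^sup>2)"
    using K by (intro add_left_mono mult_right_mono sum_nonneg) auto
  finally show ?thesis unfolding sum_mult_q b .
qed

text \<open>Continuity of the finitely many matrix entries in the standard basis suffices.\<close>

lemma bilinear_uniformly_close:
  fixes H :: "'x::topological_space \<Rightarrow> 'e::euclidean_space \<Rightarrow> 'e \<Rightarrow> real"
  assumes bil: "\<forall>\<^sub>F y in nhds y0. bilinear (H y)"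
    and cont: "\<And>a b. ((\<lambda>y. H y a b) \<longlongrightarrow> H y0 a b) (nhds y0)" and \<epsilon>: "\<epsilon> > 0"
  shows "\<forall>\<^sub>F y in nhds y0. \<forall>u v. \<bar>H y u v - H y0 u v\<bar> \<le> \<epsilon> * norm u * norm v"
proof -
  define s where "s y = (\<Sum>a\<in>Basis. \<Sum>b\<in>Basis. \<bar>H y a b - H y0 a b\<bar>)" for y
  have "(s \<longlongrightarrow> (\<Sum>a\<in>(Basis::'e set). \<Sum>b\<in>(Basis::'e set). \<bar>H y0 a b - H y0 a b\<bar>)) (nhds y0)"
    unfolding s_def by (intro tendsto_intros cont)
  then have "\<forall>\<^sub>F y in nhds y0. s y < \<epsilon>"
    using \<epsilon> by (intro order_tendstoD) auto
  then show ?thesis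
    using bil
  proof eventually_elim
    case (elim y)
    have b0: "bilinear (H y0)" using eventually_nhds_x_imp_x[OF bil] .
    show ?case
    proof (intro allI)
      fix u v
      have "H y u v - H y0 u v = (\<Sum>a\<in>Basis. \<Sum>b\<in>Basis. (u \<bullet> a) * ((v \<bullet> b) * (H y a b - H y0 a b)))"
      proof -
        have ex: "B u v = (\<Sum>a\<in>Basis. \<Sum>b\<in>Basis. (u \<bullet> a) * ((v \<bullet> b) * B a b))" if "bilinear B" for B :: "'e \<Rightarrow> 'e \<Rightarrow> real"
        proof -
          have "B u v = B (\<Sum>a\<in>Basis. (u \<bullet> a) *\<^sub>R a) (\<Sum>b\<in>Basis. (v \<bullet> b) *\<^sub>R b)"
            by (simp add: euclidean_representation)
          also have "\<dots> = (\<Sum>a\<in>Basis. \<Sum>b\<in>Basis. (u \<bullet> a) * ((v \<bullet> b) * B a b))"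
            by (subst bilinear_sum_left[OF that]) (simp add: bilinear_sum_right[OF that] sum_distrib_left)
          finally show ?thesis .
        qed
        show ?thesis
          unfolding ex[OF elim(2)] ex[OF b0] by (simp add: sum_subtractf right_diff_distrib)
      qed
      also have "\<bar>\<dots>\<bar> \<le> (\<Sum>a\<in>Basis. \<Sum>b\<in>Basis. \<bar>(u \<bullet> a) * ((v \<bullet> b) * (H y a b - H y0 a b))\<bar>)"
        by (rule order_trans[OF sum_abs], rule sum_mono, rule sum_abs)
      also have "\<dots> \<le> (\<Sum>a\<in>(Basis::'e set). \<Sum>b\<in>(Basis::'e set). (norm u * norm v) * \<bar>H y a b - H y0 a b\<bar>)"
      proof (intro sum_mono)
        fix a b :: 'e assume "a \<in> Basis" "b \<in> Basis"
        then show "\<bar>(u \<bullet> a) * ((v \<bullet> b) * (H y a b - H y0 a b))\<bar> \<le> (norm u * norm v) * \<bar>H y a b - H y0 a b\<bar>"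
          by (simp add: abs_mult mult.assoc[symmetric] Basis_le_norm mult_mono mult_right_mono)
      qed
      also have "\<dots> = (norm u * norm v) * s y" by (simp add: s_def sum_distrib_left)
      also have "\<dots> \<le> (norm u * norm v) * \<epsilon>" using elim(1) by (intro mult_left_mono) auto
      finally show "\<bar>H y u v - H y0 u v\<bar> \<le> \<epsilon> * norm u * norm v" by (simp add: mult_ac)
    qed
  qed
qed

lemma inner_form_coercive_near:
  fixes H :: "'x::topological_space \<Rightarrow> 'e::euclidean_space \<Rightarrow> 'e \<Rightarrow> real"
  assumes bil: "\<forall>\<^sub>F y in nhds y0. bilinear (H y)" and "inner_form (H y0)"
    and cont: "\<And>a b. ((\<lambda>y. H y a b) \<longlongrightarrow> H y0 a b) (nhds y0)"
  obtains \<kappa> where "\<kappa> > 0" "\<forall>\<^sub>F y in nhds y0. \<forall>v. \<kappa> * (norm v)\<^sup>2 \<le> H y v v"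
proof -
  obtain \<kappa> where k: "\<kappa> > 0" "\<And>v. \<kappa> * (norm v)\<^sup>2 \<le> H y0 v v"
    using inner_form_coercive[OF assms(2)] by blast
  have "\<forall>\<^sub>F y in nhds y0. \<forall>v. (\<kappa>/2) * (norm v)\<^sup>2 \<le> H y v v"
    using bilinear_uniformly_close[OF bil cont half_gt_zero[OF k(1)]]
  proof eventually_elim
    case (elim y)
    show ?case
    proof
      fix v
      have "\<bar>H y v v - H y0 v v\<bar> \<le> \<kappa> / 2 * (norm v)\<^sup>2"
        using elim by (simp add: power2_eq_square mult.assoc)
      then show "(\<kappa>/2) * (norm v)\<^sup>2 \<le> H y v v" using k(2)[of v] by linarith
    qed
  qed
  then show ?thesis using that[of "\<kappa>/2"] k by simp
qed

text \<open>Bounds all eigenvalues of \<open>B y\<close> relative to \<open>H y\<close> from above, uniformly for \<open>y\<close> near \<open>y0\<close>.\<close>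

lemma rayleigh_quotient_bounded_near:
  fixes H B :: "'x::topological_space \<Rightarrow> 'e::euclidean_space \<Rightarrow> 'e \<Rightarrow> real"
  assumes H: "\<forall>\<^sub>F y in nhds y0. bilinear (H y)" "inner_form (H y0)"
      "\<And>a b. ((\<lambda>y. H y a b) \<longlongrightarrow> H y0 a b) (nhds y0)"
    and B: "\<forall>\<^sub>F y in nhds y0. bilinear (B y)" "\<And>a b. ((\<lambda>y. B y a b) \<longlongrightarrow> B y0 a b) (nhds y0)"
  obtains K where "\<forall>\<^sub>F y in nhds y0. \<forall>v. B y v v \<le> K * H y v v"
proof -
  obtain \<kappa> where k: "\<kappa> > 0" "\<forall>\<^sub>F y in nhds y0. \<forall>v. \<kappa> * (norm v)\<^sup>2 \<le> H y v v"
    using inner_form_coercive_near[OF H] by blast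
  obtain C where C: "C > 0" "\<And>u v. norm (B y0 u v) \<le> C * norm u * norm v"
    using bilinear_bounded_pos[OF eventually_nhds_x_imp_x[OF B(1)]] by blast
  have "\<forall>\<^sub>F y in nhds y0. \<forall>v. B y v v \<le> (C + 1) / \<kappa> * H y v v"
    using bilinear_uniformly_close[OF B zero_less_one] k(2)
  proof eventually_elim
    case (elim y)
    show ?case
    proof
      fix v
      have "B y v v \<le> (C + 1) * (norm v)\<^sup>2"
        using elim(1)[rule_format, of v v] C(2)[of v v]
        by (simp add: algebra_simps power2_eq_square abs_le_iff)
      also have "\<dots> = (C + 1) / \<kappa> * (\<kappa> * (norm v)\<^sup>2)" using k(1) by simp
      also have "\<dots> \<le> (C + 1) / \<kappa> * H y v v"
        using elim(2) k(1) C(1) by (intro mult_left_mono) auto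
      finally show "B y v v \<le> (C + 1) / \<kappa> * H y v v" .
    qed
  qed
  then show ?thesis using that by blast
qed

section \<open>Second order expansions along curves\<close>

text \<open>The numbers \<open>d1\<close> and \<open>d2\<close> are the first two derivatives of \<open>\<phi>\<close> at \<open>0\<close>; the second one exists in the
weakest sense, that is, the first derivative exists near \<open>0\<close> and is differentiable at \<open>0\<close>.\<close>

definition jet2 :: "(real \<Rightarrow> real) \<Rightarrow> real \<Rightarrow> real \<Rightarrow> bool" where
  "jet2 \<phi> d1 d2 \<longleftrightarrow> (\<exists>\<phi>'. (\<forall>\<^sub>F t in nhds 0. (\<phi> has_real_derivative \<phi>' t) (at t)) \<and>
     \<phi>' 0 = d1 \<and> (\<phi>' has_real_derivative d2) (at 0))"

lemma jet2_const: "jet2 (\<lambda>_. c) 0 0"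
  unfolding jet2_def by (intro exI[of _ "\<lambda>_. 0"]) auto

lemma jet2_ident: "jet2 (\<lambda>t. t) 1 0"
  unfolding jet2_def by (intro exI[of _ "\<lambda>_. 1"]) auto

lemma jet2_add:
  assumes "jet2 \<phi> a b" "jet2 \<psi> c d"
  shows "jet2 (\<lambda>t. \<phi> t + \<psi> t) (a + c) (b + d)"
proof -
  obtain \<phi>' \<psi>' where
    p: "\<forall>\<^sub>F t in nhds 0. (\<phi> has_real_derivative \<phi>' t) (at t)" "\<phi>' 0 = a" "(\<phi>' has_real_derivative b) (at 0)" and
    q: "\<forall>\<^sub>F t in nhds 0. (\<psi> has_real_derivative \<psi>' t) (at t)" "\<psi>' 0 = c" "(\<psi>' has_real_derivative d) (at 0)"
    using assms unfolding jet2_def by blast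
  have "\<forall>\<^sub>F t in nhds 0. ((\<lambda>t. \<phi> t + \<psi> t) has_real_derivative \<phi>' t + \<psi>' t) (at t)"
    using p(1) q(1) by eventually_elim (intro derivative_intros)
  moreover have "((\<lambda>t. \<phi>' t + \<psi>' t) has_real_derivative b + d) (at 0)"
    by (intro derivative_intros p q)
  ultimately show ?thesis unfolding jet2_def using p(2) q(2) by (intro exI[of _ "\<lambda>t. \<phi>' t + \<psi>' t"]) simp
qed

lemma jet2_mult:
  assumes "jet2 \<phi> a b" "jet2 \<psi> c d"
  shows "jet2 (\<lambda>t. \<phi> t * \<psi> t) (a * \<psi> 0 + \<phi> 0 * c) (b * \<psi> 0 + 2 * a * c + \<phi> 0 * d)"
proof -
  obtain \<phi>' \<psi>' where
    p: "\<forall>\<^sub>F t in nhds 0. (\<phi> has_real_derivative \<phi>' t) (at t)" "\<phi>' 0 = a" "(\<phi>' has_real_derivative b) (at 0)" and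
    q: "\<forall>\<^sub>F t in nhds 0. (\<psi> has_real_derivative \<psi>' t) (at t)" "\<psi>' 0 = c" "(\<psi>' has_real_derivative d) (at 0)"
    using assms unfolding jet2_def by blast
  have "\<forall>\<^sub>F t in nhds 0. ((\<lambda>t. \<phi> t * \<psi> t) has_real_derivative \<phi>' t * \<psi> t + \<psi>' t * \<phi> t) (at t)"
    using p(1) q(1) by eventually_elim (rule DERIV_mult)
  moreover have "((\<lambda>t. \<phi>' t * \<psi> t + \<psi>' t * \<phi> t) has_real_derivative b * \<psi> 0 + 2 * a * c + \<phi> 0 * d) (at 0)"
    using eventually_nhds_x_imp_x[OF p(1)] eventually_nhds_x_imp_x[OF q(1)] p(2,3) q(2,3)
    by (auto intro!: derivative_eq_intros simp: algebra_simps)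
  ultimately show ?thesis unfolding jet2_def using p(2) q(2)
    by (intro exI[of _ "\<lambda>t. \<phi>' t * \<psi> t + \<psi>' t * \<phi> t"]) simp
qed

lemma jet2_cmult: "jet2 \<phi> a b \<Longrightarrow> jet2 (\<lambda>t. c * \<phi> t) (c * a) (c * b)"
  using jet2_mult[OF jet2_const, of \<phi> a b c] by simp

lemma jet2_diff: "jet2 \<phi> a b \<Longrightarrow> jet2 \<psi> c d \<Longrightarrow> jet2 (\<lambda>t. \<phi> t - \<psi> t) (a - c) (b - d)"
  using jet2_add[OF _ jet2_cmult[of \<psi> c d "-1"], of \<phi> a b] by simp

lemma jet2_sum:
  "(\<And>k. k \<in> I \<Longrightarrow> jet2 (\<phi> k) (a k) (b k)) \<Longrightarrow> jet2 (\<lambda>t. \<Sum>k\<in>I. \<phi> k t) (\<Sum>k\<in>I. a k) (\<Sum>k\<in>I. b k)"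
proof (induction I rule: infinite_finite_induct)
  case (insert x F)
  then show ?case using jet2_add[of "\<phi> x" "a x" "b x"] by simp
qed (simp_all add: jet2_const)

lemma jet2_imp_DERIV: "jet2 \<phi> a b \<Longrightarrow> (\<phi> has_real_derivative a) (at 0)"
  unfolding jet2_def using eventually_nhds_x_imp_x by fastforce

text \<open>First and second order conditions at a minimum survive an error term that is \<open>o(t\<^sup>2)\<close>: dividing by \<open>t\<close> on
both sides of \<open>0\<close> gives the first one, dividing by \<open>t\<^sup>2\<close> the second one.\<close>

lemma jet2_nonneg_minimum:
  assumes jet: "jet2 \<phi> a b" and "\<phi> 0 = 0"
    and R: "((\<lambda>t. R t / t\<^sup>2) \<longlongrightarrow> 0) (at 0)"
    and nonneg: "\<forall>\<^sub>F t in at 0. 0 \<le> \<phi> t + R t"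
  shows "a = 0" "b \<ge> 0"
proof -
  obtain \<phi>' where p: "\<forall>\<^sub>F t in nhds 0. (\<phi> has_real_derivative \<phi>' t) (at t)" "\<phi>' 0 = a"
    "(\<phi>' has_real_derivative b) (at 0)"
    using jet unfolding jet2_def by blast
  have d1: "((\<lambda>t. \<phi> t / t) \<longlongrightarrow> a) (at 0)"
    using jet2_imp_DERIV[OF jet] \<open>\<phi> 0 = 0\<close> by (simp add: has_field_derivative_iff)
  have R_div: "R t / t\<^sup>2 * t = R t / t" for t
    by (cases "t = 0") (simp_all add: power2_eq_square)
  have "((\<lambda>t. R t / t\<^sup>2 * t) \<longlongrightarrow> 0 * 0) (at 0)"
    by (intro tendsto_mult R tendsto_ident_at)
  then have "((\<lambda>t. R t / t) \<longlongrightarrow> 0) (at 0)"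
    unfolding R_div by simp
  from tendsto_add[OF d1 this] have lim1: "((\<lambda>t. (\<phi> t + R t) / t) \<longlongrightarrow> a) (at 0)"
    by (simp add: add_divide_distrib)
  have "0 \<le> a"
  proof (rule tendsto_lowerbound)
    show "((\<lambda>t. (\<phi> t + R t) / t) \<longlongrightarrow> a) (at_right 0)"
      using lim1 by (rule tendsto_within_subset) simp
    have "\<forall>\<^sub>F t in at_right (0::real). 0 \<le> \<phi> t + R t"
      using nonneg eventually_at_split by blast
    then show "\<forall>\<^sub>F t in at_right 0. 0 \<le> (\<phi> t + R t) / t"
      using eventually_at_right_less by eventually_elim simp
  qed simp
  moreover have "a \<le> 0"
  proof (rule tendsto_upperbound)
    show "((\<lambda>t. (\<phi> t + R t) / t) \<longlongrightarrow> a) (at_left 0)"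
      using lim1 by (rule tendsto_within_subset) simp
    have "\<forall>\<^sub>F t in at_left (0::real). 0 \<le> \<phi> t + R t"
      using nonneg eventually_at_split by blast
    moreover have "\<forall>\<^sub>F t in at_left (0::real). t < 0" by (simp add: eventually_at_filter)
    ultimately show "\<forall>\<^sub>F t in at_left 0. (\<phi> t + R t) / t \<le> 0"
      by eventually_elim (simp add: divide_nonneg_neg)
  qed simp
  ultimately show a: "a = 0" by simp
  have "((\<lambda>t. \<phi> t / t\<^sup>2) \<longlongrightarrow> b / 2) (at 0)"
  proof (rule lhopital)
    show "(\<phi> \<longlongrightarrow> 0) (at 0)"
      using DERIV_isCont[OF jet2_imp_DERIV[OF jet]] \<open>\<phi> 0 = 0\<close> by (simp add: isCont_def)
    show "((\<lambda>t. t\<^sup>2) \<longlongrightarrow> 0) (at (0::real))" by (auto intro!: tendsto_eq_intros)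
    show "\<forall>\<^sub>F t in at 0. t\<^sup>2 \<noteq> (0::real)" "\<forall>\<^sub>F t in at 0. 2 * t \<noteq> (0::real)"
      by (simp_all add: eventually_at_filter)
    show "\<forall>\<^sub>F t in at 0. (\<phi> has_real_derivative \<phi>' t) (at t)"
      using p(1) by (simp add: eventually_at_filter eventually_mono)
    show "\<forall>\<^sub>F t in at 0. ((\<lambda>t. t\<^sup>2) has_real_derivative 2 * t) (at t)"
      by (auto intro!: always_eventually derivative_eq_intros)
    have "((\<lambda>t. \<phi>' t / t) \<longlongrightarrow> b) (at 0)"
      using p(2,3) a by (simp add: has_field_derivative_iff)
    from tendsto_divide[OF this tendsto_const[of 2]]
    show "((\<lambda>t. \<phi>' t / (2 * t)) \<longlongrightarrow> b / 2) (at 0)" by (simp add: mult.commute)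
  qed
  from tendsto_add[OF this R] have "((\<lambda>t. (\<phi> t + R t) / t\<^sup>2) \<longlongrightarrow> b / 2) (at 0)"
    by (simp add: add_divide_distrib)
  moreover have "\<forall>\<^sub>F t in at 0. 0 \<le> (\<phi> t + R t) / t\<^sup>2"
    using nonneg by eventually_elim simp
  ultimately have "0 \<le> b / 2" by (rule tendsto_lowerbound) simp
  then show "b \<ge> 0" by simp
qed

lemma has_real_derivative_along_curve:
  fixes b :: "'e::euclidean_space \<Rightarrow> real"
  assumes "(y has_vector_derivative y') (at t)" "b differentiable (at (y t))"
  shows "((\<lambda>t. b (y t)) has_real_derivative frechet_derivative b (at (y t)) y') (at t)"
proof -
  have l: "linear (frechet_derivative b (at (y t)))"
    using assms(2) by (rule linear_frechet_derivative)
  have "((\<lambda>t. b (y t)) has_derivative (\<lambda>s. frechet_derivative b (at (y t)) (s *\<^sub>R y'))) (at t)"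
    using assms unfolding has_vector_derivative_def frechet_derivative_works
    by (rule has_derivative_compose)
  then show ?thesis
    by (simp add: has_field_derivative_def linear_scale[OF l] mult.commute[of "frechet_derivative _ _ _"] mult_commute_abs)
qed

lemma Ck_on_2D:
  assumes "Ck_on 2 U b" "y \<in> U"
  shows "b differentiable (at y)" "(\<lambda>x. frechet_derivative b (at x) v) differentiable (at y)"
  using assms by (auto simp: numeral_2_eq_2)

text \<open>For \<open>z = \<nabla>\<^bsub>u\<^esub> u\<close> the curve is a geodesic up to second order, and the second derivative below is the
covariant Hessian of \<open>b\<close>.\<close>

lemma jet2_along_curve:
  fixes b :: "'e::euclidean_space \<Rightarrow> real"
  assumes U: "open U" "y0 \<in> U" and b: "Ck_on 2 U b"
  shows "jet2 (\<lambda>t. b (y0 + t *\<^sub>R u - (t\<^sup>2 / 2) *\<^sub>R z)) (frechet_derivative b (at y0) u)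
    (frechet_derivative (\<lambda>x. frechet_derivative b (at x) u) (at y0) u - frechet_derivative b (at y0) z)"
proof -
  define y where "y t = y0 + t *\<^sub>R u - (t\<^sup>2 / 2) *\<^sub>R z" for t
  define D where "D v x = frechet_derivative b (at x) v" for v x
  have [simp]: "y 0 = y0" by (simp add: y_def)
  have y': "(y has_vector_derivative (u - t *\<^sub>R z)) (at t)" for t
    unfolding y_def by (auto intro!: derivative_eq_intros)
  have "continuous (at 0) y" using y' by (rule has_vector_derivative_continuous)
  then have "(y \<longlongrightarrow> y0) (nhds 0)"
    using tendsto_at_iff_tendsto_nhds[of y 0] by (simp add: continuous_at)
  then have inU: "\<forall>\<^sub>F t in nhds 0. y t \<in> U" using U by (rule topological_tendstoD)
  have lin: "D (u - t *\<^sub>R z) x = D u x - t * D z x" if "x \<in> U" for t x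
    using linear_frechet_derivative[OF Ck_on_2D(1)[OF b that]]
    by (simp add: D_def linear_diff linear_scale)
  have "\<forall>\<^sub>F t in nhds 0. ((\<lambda>t. b (y t)) has_real_derivative (D u (y t) - t * D z (y t))) (at t)"
    using inU
  proof eventually_elim
    case (elim t)
    from has_real_derivative_along_curve[OF y' Ck_on_2D(1)[OF b elim]]
    show ?case using lin[OF elim, of t] by (simp add: D_def)
  qed
  moreover have "((\<lambda>t. D u (y t) - t * D z (y t)) has_real_derivative
      (frechet_derivative (D u) (at y0) u - D z y0)) (at 0)"
  proof -
    have "((\<lambda>t. D v (y t)) has_real_derivative frechet_derivative (D v) (at y0) u) (at 0)" for v
      using has_real_derivative_along_curve[OF y', of "D v" 0] Ck_on_2D(2)[OF b U(2), of v]
      by (simp add: D_def[abs_def])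
    from DERIV_diff[OF this[of u] DERIV_mult[OF DERIV_ident this[of z]]]
    show ?thesis by simp
  qed
  ultimately show ?thesis
    unfolding jet2_def y_def[symmetric] D_def[symmetric]
    by (intro exI[of _ "\<lambda>t. D u (y t) - t * D z (y t)"]) (simp add: D_def)
qed

text \<open>A product rule that needs only continuity of the factor \<open>s\<close>, because the other factor vanishes at \<open>x\<close>.\<close>

lemma has_derivative_mult_vanishing:
  fixes r s :: "'e::real_normed_vector \<Rightarrow> real"
  assumes r: "(r has_derivative r') (at x)" "r x = 0" and s: "(s \<longlongrightarrow> s x) (at x)"
  shows "((\<lambda>y. s y * r y) has_derivative (\<lambda>w. s x * r' w)) (at x)"
proof -
  have bl: "bounded_linear r'" using r(1) by (rule has_derivative_bounded_linear)
  define e where "e y = norm (r y - r x - r' (y - x)) / norm (y - x)" for y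
  have e: "(e \<longlongrightarrow> 0) (at x)" using r(1) unfolding has_derivative_iff_norm e_def by simp
  obtain C where C: "\<And>v. norm (r' v) \<le> norm v * C"
    using bounded_linear.bounded[OF bl] by blast
  have "((\<lambda>y. norm (s y * r y - s x * r x - s x * r' (y - x)) / norm (y - x)) \<longlongrightarrow> 0) (at x)"
  proof (rule tendsto_sandwich[where f = "\<lambda>_. 0"])
    show "((\<lambda>y. \<bar>s y - s x\<bar> * (e y + C) + \<bar>s x\<bar> * e y) \<longlongrightarrow> 0) (at x)"
      using s e by (auto intro!: tendsto_eq_intros)
    show "\<forall>\<^sub>F y in at x. norm (s y * r y - s x * r x - s x * r' (y - x)) / norm (y - x)
        \<le> \<bar>s y - s x\<bar> * (e y + C) + \<bar>s x\<bar> * e y"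
      unfolding eventually_at_filter
    proof (intro always_eventually allI impI)
      fix y assume "y \<noteq> x"
      then have n: "norm (y - x) > 0" by simp
      have ey: "\<bar>r y - r' (y - x)\<bar> = e y * norm (y - x)" using n r(2) by (simp add: e_def)
      have "\<bar>r y\<bar> \<le> \<bar>r y - r' (y - x)\<bar> + \<bar>r' (y - x)\<bar>" by simp
      then have ry: "\<bar>r y\<bar> \<le> (e y + C) * norm (y - x)"
        using C[of "y - x"] by (simp add: ey algebra_simps)
      have "s y * r y - s x * r x - s x * r' (y - x) = (s y - s x) * r y + s x * (r y - r' (y - x))"
        using r(2) by (simp add: algebra_simps)
      then have "\<bar>s y * r y - s x * r x - s x * r' (y - x)\<bar>
          \<le> \<bar>s y - s x\<bar> * \<bar>r y\<bar> + \<bar>s x\<bar> * \<bar>r y - r' (y - x)\<bar>"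
        by (metis abs_mult abs_triangle_ineq)
      also have "\<dots> \<le> \<bar>s y - s x\<bar> * ((e y + C) * norm (y - x)) + \<bar>s x\<bar> * (e y * norm (y - x))"
        unfolding ey by (intro add_right_mono mult_left_mono ry) simp
      also have "\<dots> = (\<bar>s y - s x\<bar> * (e y + C) + \<bar>s x\<bar> * e y) * norm (y - x)"
        by (simp add: algebra_simps)
      finally show "norm (s y * r y - s x * r x - s x * r' (y - x)) / norm (y - x)
        \<le> \<bar>s y - s x\<bar> * (e y + C) + \<bar>s x\<bar> * e y"
        using n by (simp add: pos_divide_le_eq)
    qed
  qed (auto intro!: always_eventually)
  then show ?thesis
    unfolding has_derivative_iff_norm using bounded_linear_const_mult[OF bl, of "s x"] by simp
qed

section \<open>The Levi-Civita connection in a chart\<close>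

definition symmetric_form_field :: "'e::euclidean_space set \<Rightarrow> ('e \<Rightarrow> 'e list \<Rightarrow> real) \<Rightarrow> bool" where
  "symmetric_form_field U B \<longleftrightarrow>
     (\<forall>y\<in>U. bilinear (\<lambda>u v. B y [u, v]) \<and> (\<forall>u v. B y [u, v] = B y [v, u])) \<and>
     (\<forall>u v. Ck_on 2 U (\<lambda>y. B y [u, v]))"

definition metric_field :: "'e::euclidean_space set \<Rightarrow> ('e \<Rightarrow> 'e list \<Rightarrow> real) \<Rightarrow> bool" where
  "metric_field U G \<longleftrightarrow> symmetric_form_field U G \<and> (\<forall>y\<in>U. inner_form (\<lambda>u v. G y [u, v]))"

definition form_deriv :: "('e::euclidean_space \<Rightarrow> 'e list \<Rightarrow> real) \<Rightarrow> 'e \<Rightarrow> 'e \<Rightarrow> 'e \<Rightarrow> 'e \<Rightarrow> real" where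
  "form_deriv B y w u v = frechet_derivative (\<lambda>x. B x [u, v]) (at y) w"

lemma symmetric_form_fieldD:
  assumes "symmetric_form_field U B" "y \<in> U"
  shows "bilinear (\<lambda>u v. B y [u, v])" "B y [u, v] = B y [v, u]"
    "(\<lambda>y. B y [u, v]) differentiable (at y)" "(\<lambda>y. form_deriv B y w u v) differentiable (at y)"
    "((\<lambda>y. B y [u, v]) has_derivative (\<lambda>w. form_deriv B y w u v)) (at y)"
  using assms Ck_on_2D(1)[of U "\<lambda>y. B y [u, v]" y] Ck_on_2D(2)[of U "\<lambda>y. B y [u, v]" y w]
  by (auto simp: symmetric_form_field_def form_deriv_def frechet_derivative_works[symmetric])

lemma symmetric_form_field_tendsto:
  assumes "symmetric_form_field U B" "y \<in> U"
  shows "((\<lambda>y. B y [u, v]) \<longlongrightarrow> B y [u, v]) (nhds y)"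
    "((\<lambda>y. form_deriv B y w u v) \<longlongrightarrow> form_deriv B y w u v) (nhds y)"
  using symmetric_form_fieldD(3)[OF assms, of u v] symmetric_form_fieldD(4)[OF assms, of w u v]
  by (auto dest!: differentiable_imp_continuous_within simp: continuous_within
      tendsto_at_iff_tendsto_nhds[of "\<lambda>y. B y [u, v]" y] tendsto_at_iff_tendsto_nhds[of "\<lambda>y. form_deriv B y w u v" y])

text \<open>The form is only controlled on \<open>U\<close>, so algebraic identities between derivatives come from identities that
hold on this open set.\<close>

lemma form_deriv_eqI:
  assumes "symmetric_form_field U B" "open U" "y \<in> U" "(h has_derivative h') (at y)"
    "\<And>x. x \<in> U \<Longrightarrow> B x [u, v] = h x"
  shows "form_deriv B y w u v = h' w"
proof -
  have "((\<lambda>x. B x [u, v]) has_derivative h') (at y)"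
    using has_derivative_transform_within_open[OF assms(4,2,3)] assms(5) by simp
  from frechet_derivative_at[OF this] show ?thesis by (simp add: form_deriv_def)
qed

lemma form_deriv_linear:
  assumes B: "symmetric_form_field U B" and U: "open U" "y \<in> U"
  shows "linear (\<lambda>w. form_deriv B y w u v)" "bilinear (form_deriv B y w)"
    "form_deriv B y w u v = form_deriv B y w v u"
proof -
  note D = symmetric_form_fieldD(5)[OF B U(2)]
  note bil = bilinear_simps[OF symmetric_form_fieldD(1)[OF B]]
  show "linear (\<lambda>w. form_deriv B y w u v)"
    using D[of u v] has_derivative_linear by blast
  show "form_deriv B y w u v = form_deriv B y w v u" for u v
    by (rule form_deriv_eqI[OF B U D]) (rule symmetric_form_fieldD(2)[OF B])
  have l: "linear (\<lambda>u. form_deriv B y w u v)" for v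
  proof (rule linearI)
    fix a b r
    show "form_deriv B y w (a + b) v = form_deriv B y w a v + form_deriv B y w b v"
      by (rule form_deriv_eqI[OF B U has_derivative_add[OF D D]]) (simp add: bil)
    show "form_deriv B y w (r *\<^sub>R a) v = r *\<^sub>R form_deriv B y w a v"
      by (rule form_deriv_eqI[OF B U has_derivative_scaleR_right[OF D]]) (simp add: bil)
  qed
  then show "bilinear (form_deriv B y w)"
    unfolding bilinear_def
    by (simp add: \<open>\<And>v u. form_deriv B y w u v = form_deriv B y w v u\<close>[of _ v for v] l)
qed

lemma inner_form_eqI:
  assumes "inner_form H" "\<And>w. H a w = H b w"
  shows "a = b"
proof (rule ccontr)
  assume "a \<noteq> b"
  then have "H (a - b) (a - b) > 0" using assms(1) by (simp add: inner_form_def)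
  moreover have "H (a - b) (a - b) = H a (a - b) - H b (a - b)"
    using assms(1) by (simp add: inner_form_def bilinear_simps)
  ultimately show False using assms(2) by simp
qed

text \<open>One basis \<open>f\<close> represents every functional by an explicit formula, so that the representing vector is
visibly linear in parameters on which the functional depends linearly.\<close>

lemma riesz_representation:
  fixes H :: "'e::euclidean_space \<Rightarrow> 'e \<Rightarrow> real"
  assumes H: "inner_form H"
  obtains f :: "nat \<Rightarrow> 'e" where "\<And>l w. linear l \<Longrightarrow> H (\<Sum>j=1..DIM('e). l (f j) *\<^sub>R f j) w = l w"
proof -
  have bil: "bilinear H" and sym: "\<And>u v. H u v = H v u"
    using H by (auto simp: inner_form_def)
  obtain f \<mu> where "eigenframe H H DIM('e) f \<mu>"
    using eigenframe_exists[OF H bil sym] by blast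
  then have on: "orthonormal_family H {1..DIM('e)} f" by (simp add: eigenframe_def)
  have "H (\<Sum>j=1..DIM('e). l (f j) *\<^sub>R f j) w = l w" if l: "linear l" for l w
  proof -
    have "l w = l (\<Sum>j=1..DIM('e). H w (f j) *\<^sub>R f j)"
      by (rule arg_cong[of w _ l], rule orthonormal_expansion[OF bil _ on])
        (use orthonormal_family_span[OF bil on] in auto)
    also have "\<dots> = (\<Sum>j=1..DIM('e). H w (f j) * l (f j))"
      by (simp add: linear_sum[OF l] linear_scale[OF l])
    finally show ?thesis by (simp add: bilinear_sum_left[OF bil] sym[of "f _"] mult.commute)
  qed
  then show ?thesis using that by blast
qed

definition koszul :: "('e::euclidean_space \<Rightarrow> 'e list \<Rightarrow> real) \<Rightarrow> 'e \<Rightarrow> 'e \<Rightarrow> 'e \<Rightarrow> 'e \<Rightarrow> real" where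
  "koszul G y u v w = (form_deriv G y u v w + form_deriv G y v u w - form_deriv G y w u v) / 2"

text \<open>The fundamental theorem of Riemannian geometry in a chart. Combining three instances of metric compatibility
by symmetry forces the Koszul formula, hence uniqueness; the vectors that represent the Koszul functional
satisfy the defining conditions.\<close>

lemma levi_civita_coeff:
  fixes G :: "'e::euclidean_space \<Rightarrow> 'e list \<Rightarrow> real"
  assumes G: "metric_field U G" and U: "open U" "y \<in> U"
  shows "bilinear (levi_civita_coeff G y)"
    and "levi_civita_coeff G y u v = levi_civita_coeff G y v u"
    and "form_deriv G y w u v =
      G y [levi_civita_coeff G y w u, v] + G y [u, levi_civita_coeff G y w v]"
    and "G y [levi_civita_coeff G y u v, w] = koszul G y u v w"
proof -
  have GS: "symmetric_form_field U G" and Gi: "inner_form (\<lambda>u v. G y [u, v])"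
    using G U by (auto simp: metric_field_def)
  have sym: "G y [u, v] = G y [v, u]" for u v
    using symmetric_form_fieldD(2)[OF GS U(2)] .
  note L = form_deriv_linear(1)[OF GS U] and Bl = form_deriv_linear(2)[OF GS U]
  note simps = bilinear_simps[OF Bl] linear_add[OF L] linear_scale[OF L]
  have Dsym: "form_deriv G y w u v = form_deriv G y w v u" for u v w
    by (rule form_deriv_linear(3)[OF GS U])
  let ?P = "\<lambda>\<Gamma>. bilinear \<Gamma> \<and> (\<forall>u v. \<Gamma> u v = \<Gamma> v u) \<and>
     (\<forall>u v w. frechet_derivative (\<lambda>y. G y [u, v]) (at y) w = G y [\<Gamma> w u, v] + G y [u, \<Gamma> w v])"
  have kos: "G y [\<Gamma> u v, w] = koszul G y u v w" if P: "?P \<Gamma>" for \<Gamma> u v w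
  proof -
    have c: "form_deriv G y w u v = G y [\<Gamma> w u, v] + G y [\<Gamma> w v, u]" for u v w
      using P sym[of u] by (simp add: form_deriv_def)
    have s: "\<Gamma> u v = \<Gamma> v u" for u v using P by blast
    show ?thesis
      unfolding koszul_def c using s[of u v] s[of u w] s[of v w] by simp
  qed
  obtain f :: "nat \<Rightarrow> 'e" where
    f: "\<And>l w. linear l \<Longrightarrow> G y [\<Sum>j=1..DIM('e). l (f j) *\<^sub>R f j, w] = l w"
    using riesz_representation[OF Gi] by blast
  define \<Gamma> where "\<Gamma> u v = (\<Sum>j=1..DIM('e). koszul G y u v (f j) *\<^sub>R f j)" for u v
  have lin: "linear (\<lambda>w. koszul G y u v w)" "linear (\<lambda>u. koszul G y u v w)" "linear (\<lambda>v. koszul G y u v w)" for u v w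
    by (rule linearI; simp add: koszul_def simps field_simps)+
  have Gam: "G y [\<Gamma> u v, w] = koszul G y u v w" for u v w
    unfolding \<Gamma>_def by (rule f[OF lin(1)])
  have "?P \<Gamma>"
  proof (intro conjI allI)
    show "bilinear \<Gamma>"
      unfolding bilinear_def \<Gamma>_def
      by (intro conjI allI linearI; simp add: linear_add[OF lin(2)] linear_add[OF lin(3)]
        linear_scale[OF lin(2)] linear_scale[OF lin(3)] sum.distrib scaleR_left_distrib scaleR_sum_right)
    show "\<Gamma> u v = \<Gamma> v u" for u v
      unfolding \<Gamma>_def koszul_def by (simp add: Dsym[of _ u v] add.commute)
    show "frechet_derivative (\<lambda>y. G y [u, v]) (at y) w = G y [\<Gamma> w u, v] + G y [u, \<Gamma> w v]" for u v w
      unfolding sym[of u] Gam form_deriv_def[symmetric]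
      by (simp add: koszul_def Dsym[of u v w] Dsym[of v u w] Dsym[of w v u] field_simps)
  qed
  moreover have "\<Gamma>' = \<Gamma>" if "?P \<Gamma>'" for \<Gamma>'
    by (intro ext inner_form_eqI[OF Gi]) (simp add: kos[OF that] Gam)
  ultimately have P: "?P (levi_civita_coeff G y)"
    unfolding levi_civita_coeff_def by (rule theI)
  then show "bilinear (levi_civita_coeff G y)" "levi_civita_coeff G y u v = levi_civita_coeff G y v u"
    "form_deriv G y w u v = G y [levi_civita_coeff G y w u, v] + G y [u, levi_civita_coeff G y w v]"
    unfolding form_deriv_def by blast+
  show "G y [levi_civita_coeff G y u v, w] = koszul G y u v w"
    by (rule kos[OF P])
qed

text \<open>The difference of the coefficients at \<open>y\<close> and \<open>y0\<close> is controlled by pairing it with itself in the metric at \<open>y\<close>,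
which is uniformly coercive near \<open>y0\<close>. The Koszul formula turns this pairing into continuous terms.\<close>

lemma levi_civita_coeff_continuous:
  fixes G :: "'e::euclidean_space \<Rightarrow> 'e list \<Rightarrow> real"
  assumes G: "metric_field U G" and U: "open U" "y0 \<in> U"
  shows "((\<lambda>y. levi_civita_coeff G y u v) \<longlongrightarrow> levi_civita_coeff G y0 u v) (nhds y0)"
proof -
  have GS: "symmetric_form_field U G" using G by (simp add: metric_field_def)
  have inU: "\<forall>\<^sub>F y in nhds y0. y \<in> U" using U by (rule eventually_nhds_in_open)
  have bil: "\<forall>\<^sub>F y in nhds y0. bilinear (\<lambda>u v. G y [u, v])"
    using inU by eventually_elim (rule symmetric_form_fieldD(1)[OF GS])
  obtain \<kappa> where k: "\<kappa> > 0" "\<forall>\<^sub>F y in nhds y0. \<forall>v. \<kappa> * (norm v)\<^sup>2 \<le> G y [v, v]"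
    using inner_form_coercive_near[of "\<lambda>y u v. G y [u, v]" y0, OF bil]
      G U symmetric_form_field_tendsto(1)[OF GS U(2)] by (auto simp: metric_field_def)
  let ?\<Gamma> = "\<lambda>y. levi_civita_coeff G y u v"
  define r where "r y b = koszul G y u v b - G y [?\<Gamma> y0, b]" for y b
  have "((\<lambda>y. \<Sum>b\<in>Basis. \<bar>r y b\<bar>) \<longlongrightarrow> (\<Sum>b\<in>Basis. \<bar>r y0 b\<bar>)) (nhds y0)"
    unfolding r_def koszul_def by (intro tendsto_intros symmetric_form_field_tendsto[OF GS U(2)]) simp
  moreover have "r y0 b = 0" for b
    unfolding r_def by (simp add: levi_civita_coeff(4)[OF G U])
  ultimately have lim: "((\<lambda>y. (\<Sum>b\<in>Basis. \<bar>r y b\<bar>) / \<kappa>) \<longlongrightarrow> 0 / \<kappa>) (nhds y0)"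
    using k(1) by (intro tendsto_divide) auto
  have "\<forall>\<^sub>F y in nhds y0. norm (?\<Gamma> y - ?\<Gamma> y0) \<le> (\<Sum>b\<in>Basis. \<bar>r y b\<bar>) / \<kappa>"
    using k(2) inU
  proof eventually_elim
    case (elim y)
    define d where "d = ?\<Gamma> y - ?\<Gamma> y0"
    note bl = symmetric_form_fieldD(1)[OF GS elim(2)]
    have "\<kappa> * (norm d)\<^sup>2 \<le> G y [d, d]" using elim(1) by blast
    also have "G y [d, d] = G y [d, \<Sum>b\<in>Basis. (d \<bullet> b) *\<^sub>R b]" by (simp add: euclidean_representation)
    also have "\<dots> = (\<Sum>b\<in>Basis. (d \<bullet> b) * G y [d, b])"
      using bilinear_sum_right[OF bl] by simp
    also have "\<dots> = (\<Sum>b\<in>Basis. (d \<bullet> b) * r y b)"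
      unfolding d_def r_def bilinear_lsub[OF bl] levi_civita_coeff(4)[OF G U(1) elim(2)] ..
    also have "\<dots> \<le> (\<Sum>b\<in>Basis. norm d * \<bar>r y b\<bar>)"
    proof (rule sum_mono)
      fix b :: 'e assume "b \<in> Basis"
      then have "\<bar>(d \<bullet> b) * r y b\<bar> \<le> norm d * \<bar>r y b\<bar>"
        by (simp add: abs_mult Basis_le_norm mult_right_mono)
      then show "(d \<bullet> b) * r y b \<le> norm d * \<bar>r y b\<bar>" by linarith
    qed
    finally have "norm d * (\<kappa> * norm d) \<le> norm d * (\<Sum>b\<in>Basis. \<bar>r y b\<bar>)"
      by (simp add: sum_distrib_left power2_eq_square mult_ac)
    then have "\<kappa> * norm d \<le> (\<Sum>b\<in>Basis. \<bar>r y b\<bar>)"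
      by (cases "norm d = 0") (simp_all add: sum_nonneg)
    then show ?case using k(1) unfolding d_def by (simp add: field_simps)
  qed
  then have "((\<lambda>y. ?\<Gamma> y - ?\<Gamma> y0) \<longlongrightarrow> 0) (nhds y0)"
    using lim by (simp add: Lim_null_comparison)
  then show ?thesis by (rule Lim_null[THEN iffD2])
qed

lemma local_nabla_2:
  "local_nabla G B y [a, b, w] = form_deriv B y w a b
     - B y [levi_civita_coeff G y w a, b] - B y [a, levi_civita_coeff G y w b]"
  by (simp add: local_nabla_def Let_def form_deriv_def numeral_2_eq_2)

lemma local_nabla_3:
  "local_nabla G N y [a, b, d, w] = frechet_derivative (\<lambda>x. N x [a, b, d]) (at y) w
     - N y [levi_civita_coeff G y w a, b, d] - N y [a, levi_civita_coeff G y w b, d]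
     - N y [a, b, levi_civita_coeff G y w d]"
  by (simp add: local_nabla_def Let_def numeral_3_eq_3)

text \<open>The metric is parallel.\<close>

lemma local_nabla_minus_metric:
  assumes G: "metric_field U G" and U: "open U" "y \<in> U" and B: "symmetric_form_field U B"
    and T: "\<And>y a b. T y [a, b] = B y [a, b] - c * G y [a, b]"
  shows "local_nabla G T y [a, b, w] = local_nabla G B y [a, b, w]"
proof -
  have GS: "symmetric_form_field U G" using G by (simp add: metric_field_def)
  have "((\<lambda>x. T x [a, b]) has_derivative (\<lambda>w. form_deriv B y w a b - c * form_deriv G y w a b)) (at y)"
    unfolding T by (intro derivative_intros symmetric_form_fieldD(5)[OF B U(2)] symmetric_form_fieldD(5)[OF GS U(2)])
  from frechet_derivative_at[OF this]
  have "form_deriv T y w a b = form_deriv B y w a b - c * form_deriv G y w a b"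
    by (metis form_deriv_def)
  then show ?thesis
    unfolding local_nabla_2 T levi_civita_coeff(3)[OF G U] by (simp add: algebra_simps)
qed

lemma local_nabla_bilinear:
  assumes G: "metric_field U G" and U: "open U" "y \<in> U" and B: "symmetric_form_field U B"
  shows "bilinear (\<lambda>a b. local_nabla G B y [a, b, w])"
  unfolding bilinear_def
  by (intro conjI allI linearI;
    simp add: local_nabla_2 bilinear_simps[OF form_deriv_linear(2)[OF B U]]
      bilinear_simps[OF symmetric_form_fieldD(1)[OF B U(2)]] bilinear_simps[OF levi_civita_coeff(1)[OF G U]]
      algebra_simps)

text \<open>The term \<open>N y [a, a, u]\<close> contains \<open>T y [\<Gamma> y u a, a]\<close>. As \<open>a\<close> lies in the kernel of \<open>T y0\<close>, the derivative of the
connection coefficients drops out when this is differentiated at \<open>y0\<close>, and continuity of \<open>\<Gamma>\<close> is enough.\<close>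

lemma second_local_nabla_at_kernel:
  fixes G :: "'e::euclidean_space \<Rightarrow> 'e list \<Rightarrow> real"
  assumes G: "metric_field U G" and U: "open U" "y0 \<in> U" and T: "symmetric_form_field U T"
    and ker: "\<And>v. T y0 [a, v] = 0"
    and N: "\<And>y a b w. y \<in> U \<Longrightarrow> N y [a, b, w] = local_nabla G T y [a, b, w]"
    and p: "p = levi_civita_coeff G y0 u a"
  shows "local_nabla G N y0 [a, a, u, u] =
      frechet_derivative (\<lambda>y. form_deriv T y u a a) (at y0) u
      - form_deriv T y0 (levi_civita_coeff G y0 u u) a a
      - 4 * form_deriv T y0 u a p + 2 * T y0 [p, p]"
proof -
  let ?\<Gamma> = "levi_civita_coeff G"
  have sym: "T y [v, w] = T y [w, v]" if "y \<in> U" for y v w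
    by (rule symmetric_form_fieldD(2)[OF T that])
  have ker': "T y0 [v, a] = 0" for v using ker[of v] sym[OF U(2), of v a] by simp
  have Dsym: "form_deriv T y0 w v v' = form_deriv T y0 w v' v" for v v' w
    by (rule form_deriv_linear(3)[OF T U])
  have "((\<lambda>y. T y [?\<Gamma> y u a, a]) has_derivative (\<lambda>w. form_deriv T y0 w p a)) (at y0)"
  proof -
    have "((\<lambda>y. \<Sum>b\<in>Basis. (?\<Gamma> y u a \<bullet> b) * T y [b, a]) has_derivative
        (\<lambda>w. \<Sum>b\<in>Basis. (?\<Gamma> y0 u a \<bullet> b) * form_deriv T y0 w b a)) (at y0)"
    proof (intro has_derivative_sum has_derivative_mult_vanishing)
      fix b :: 'e
      show "((\<lambda>y. T y [b, a]) has_derivative (\<lambda>w. form_deriv T y0 w b a)) (at y0)"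
        by (rule symmetric_form_fieldD(5)[OF T U(2)])
      have "(\<lambda>y. ?\<Gamma> y u a) \<midarrow>y0\<rightarrow> ?\<Gamma> y0 u a"
        using levi_civita_coeff_continuous[OF G U] tendsto_at_iff_tendsto_nhds by blast
      then show "(\<lambda>y. ?\<Gamma> y u a \<bullet> b) \<midarrow>y0\<rightarrow> ?\<Gamma> y0 u a \<bullet> b"
        by (intro tendsto_intros)
    qed (rule ker')
    moreover have "(\<Sum>b\<in>Basis. (?\<Gamma> y0 u a \<bullet> b) * form_deriv T y0 w b a) = form_deriv T y0 w p a" for w
    proof -
      have "form_deriv T y0 w p a = form_deriv T y0 w (\<Sum>b\<in>Basis. (p \<bullet> b) *\<^sub>R b) a"
        by (simp add: euclidean_representation)
      then show ?thesis
        unfolding bilinear_sum_left[OF form_deriv_linear(2)[OF T U]] p by simp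
    qed
    moreover have "(\<Sum>b\<in>Basis. (?\<Gamma> y u a \<bullet> b) * T y [b, a]) = T y [?\<Gamma> y u a, a]" if "y \<in> U" for y
      using bilinear_sum_left[OF symmetric_form_fieldD(1)[OF T that], of "\<lambda>b. ?\<Gamma> y u a \<bullet> b" "\<lambda>b. b" Basis a]
      by (simp add: euclidean_representation)
    ultimately show ?thesis
      by (simp only:) (rule has_derivative_transform_within_open[OF _ U])
  qed
  moreover have "((\<lambda>y. form_deriv T y u a a) has_derivative
      frechet_derivative (\<lambda>y. form_deriv T y u a a) (at y0)) (at y0)"
    using symmetric_form_fieldD(4)[OF T U(2)] frechet_derivative_works by blast
  ultimately have "((\<lambda>y. form_deriv T y u a a - 2 * T y [?\<Gamma> y u a, a]) has_derivative
      (\<lambda>w. frechet_derivative (\<lambda>y. form_deriv T y u a a) (at y0) w - 2 * form_deriv T y0 w p a)) (at y0)"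
    by (intro has_derivative_diff has_derivative_mult_right)
  then have "((\<lambda>y. N y [a, a, u]) has_derivative
      (\<lambda>w. frechet_derivative (\<lambda>y. form_deriv T y u a a) (at y0) w - 2 * form_deriv T y0 w p a)) (at y0)"
    by (rule has_derivative_transform_within_open[OF _ U]) (simp add: N local_nabla_2 sym[of _ a])
  from frechet_derivative_at[OF this]
  have DN: "frechet_derivative (\<lambda>y. N y [a, a, u]) (at y0) u =
      frechet_derivative (\<lambda>y. form_deriv T y u a a) (at y0) u - 2 * form_deriv T y0 u p a"
    by metis
  have Npa: "N y0 [p, a, u] = form_deriv T y0 u a p - T y0 [p, p]" "N y0 [a, p, u] = form_deriv T y0 u a p - T y0 [p, p]"
    using U(2) by (simp_all add: N local_nabla_2 ker ker' p[symmetric] Dsym[of u p a])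
  have Naa: "N y0 [a, a, w] = form_deriv T y0 w a a" for w
    using U(2) by (simp add: N local_nabla_2 ker ker')
  show ?thesis
    unfolding local_nabla_3 p[symmetric] DN Npa Naa by (simp add: Dsym[of u p a])
qed

lemma jet2_cong:
  assumes "\<forall>\<^sub>F t in nhds 0. \<phi> t = \<psi> t" "jet2 \<phi> a b"
  shows "jet2 \<psi> a b"
proof -
  obtain \<phi>' where p: "\<forall>\<^sub>F t in nhds 0. (\<phi> has_real_derivative \<phi>' t) (at t)" "\<phi>' 0 = a"
    "(\<phi>' has_real_derivative b) (at 0)"
    using assms(2) unfolding jet2_def by blast
  have "\<forall>\<^sub>F t in nhds 0. (\<psi> has_real_derivative \<phi>' t) (at t)"
    using p(1) eventually_eventually[THEN iffD2, OF assms(1)]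
    by eventually_elim (simp add: DERIV_cong_ev[OF refl _ refl])
  then show ?thesis unfolding jet2_def using p(2,3) by blast
qed

lemma jet2_form_along_curve:
  fixes T :: "'e::euclidean_space \<Rightarrow> 'e list \<Rightarrow> real"
  assumes U: "open U" "y0 \<in> U" and T: "symmetric_form_field U T"
    and y: "\<And>t. y t = y0 + t *\<^sub>R u - (t\<^sup>2 / 2) *\<^sub>R z"
  shows "jet2 (\<lambda>t. T (y t) [a + t *\<^sub>R d, b + t *\<^sub>R e])
     (form_deriv T y0 u a b + T y0 [d, b] + T y0 [a, e])
     (frechet_derivative (\<lambda>y. form_deriv T y u a b) (at y0) u - form_deriv T y0 z a b
      + 2 * form_deriv T y0 u d b + 2 * form_deriv T y0 u a e + 2 * T y0 [d, e])"
proof -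
  have [simp]: "y 0 = y0" by (simp add: y)
  have j: "jet2 (\<lambda>t. T (y t) [v, w]) (form_deriv T y0 u v w)
      (frechet_derivative (\<lambda>y. form_deriv T y u v w) (at y0) u - form_deriv T y0 z v w)" for v w
    unfolding y form_deriv_def using T U
    by (intro jet2_along_curve) (auto simp: symmetric_form_field_def)
  have J: "jet2 (\<lambda>t. T (y t) [a, b] + (t * T (y t) [d, b] + t * T (y t) [a, e]) + t * t * T (y t) [d, e])
     (form_deriv T y0 u a b + T y0 [d, b] + T y0 [a, e])
     (frechet_derivative (\<lambda>y. form_deriv T y u a b) (at y0) u - form_deriv T y0 z a b
      + 2 * form_deriv T y0 u d b + 2 * form_deriv T y0 u a e + 2 * T y0 [d, e])"
    using jet2_add[OF jet2_add[OF j[of a b] jet2_add[OF jet2_mult[OF jet2_ident j[of d b]] jet2_mult[OF jet2_ident j[of a e]]]]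
      jet2_mult[OF jet2_mult[OF jet2_ident jet2_ident] j[of d e]]]
    by (simp add: algebra_simps)
  have "continuous (at 0) y"
    unfolding y by (intro continuous_intros) simp
  then have "(y \<longlongrightarrow> y0) (nhds 0)"
    using tendsto_at_iff_tendsto_nhds[of y 0] by (simp add: continuous_at)
  then have inU: "\<forall>\<^sub>F t in nhds 0. y t \<in> U" using U by (rule topological_tendstoD)
  have eq: "\<forall>\<^sub>F t in nhds 0. T (y t) [a + t *\<^sub>R d, b + t *\<^sub>R e]
      = T (y t) [a, b] + (t * T (y t) [d, b] + t * T (y t) [a, e]) + t * t * T (y t) [d, e]"
    using inU
  proof eventually_elim
    case (elim t)
    show ?case by (simp add: bilinear_simps[OF symmetric_form_fieldD(1)[OF T elim]] algebra_simps)
  qed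
  show ?thesis
    by (rule jet2_cong[OF _ J]) (use eq in \<open>simp add: eq_commute\<close>)
qed

section \<open>Lower supports of the subtrace in a chart\<close>

text \<open>Openness of \<open>S\<close> ensures that the two-sided derivatives, which \<open>Ck_on\<close> uses, depend only on the values on \<open>S\<close>.\<close>

lemma Ck_on_cong:
  assumes "open S" "\<And>x. x \<in> S \<Longrightarrow> f x = g x" "Ck_on k S f"
  shows "Ck_on k S g"
  using assms(2,3)
proof (induction k arbitrary: f g)
  case 0
  then show ?case using continuous_on_cong[of S S f g] by simp
next
  case (Suc k)
  have d: "(g has_derivative frechet_derivative f (at x)) (at x)" if "x \<in> S" for x
    using Suc.prems that assms(1)
    by (intro has_derivative_transform_within_open[of f _ x UNIV S g])
      (auto simp: frechet_derivative_works[symmetric])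
  have eq: "frechet_derivative g (at x) = frechet_derivative f (at x)" if "x \<in> S" for x
    using frechet_derivative_at[OF d[OF that]] by simp
  have "Ck_on k S (\<lambda>x. frechet_derivative g (at x) v)" for v
    by (rule Suc.IH[of "\<lambda>x. frechet_derivative f (at x) v"]) (use Suc.prems eq in auto)
  then show ?case using d by (auto simp: differentiable_def)
qed

lemma Ck_on_diff_cmult:
  fixes f g :: "'e::euclidean_space \<Rightarrow> real"
  assumes "open S" "Ck_on k S f" "Ck_on k S g"
  shows "Ck_on k S (\<lambda>x. f x - c * g x)"
  using assms(2,3)
proof (induction k arbitrary: f g)
  case 0
  then show ?case by (auto intro!: continuous_intros)
next
  case (Suc k)
  have d: "((\<lambda>x. f x - c * g x) has_derivative
      (\<lambda>v. frechet_derivative f (at x) v - c * frechet_derivative g (at x) v)) (at x)" if "x \<in> S" for x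
    using Suc.prems that
    by (intro has_derivative_diff has_derivative_mult_right) (auto simp: frechet_derivative_works[symmetric])
  have eq: "frechet_derivative (\<lambda>x. f x - c * g x) (at x)
      = (\<lambda>v. frechet_derivative f (at x) v - c * frechet_derivative g (at x) v)" if "x \<in> S" for x
    using frechet_derivative_at[OF d[OF that]] by simp
  have "Ck_on k S (\<lambda>x. frechet_derivative (\<lambda>x. f x - c * g x) (at x) v)" for v
    by (rule Ck_on_cong[OF assms(1) _ Suc.IH[of "\<lambda>x. frechet_derivative f (at x) v" "\<lambda>x. frechet_derivative g (at x) v"]])
      (use Suc.prems eq in auto)
  then show ?case using d by (auto simp: differentiable_def)
qed

lemma symmetric_form_field_diff_cmult:
  assumes U: "open U" and B: "symmetric_form_field U B" and G: "symmetric_form_field U G"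
  shows "symmetric_form_field U (\<lambda>y as. B y as - c * G y as)"
proof -
  have "bilinear (\<lambda>u v. B y [u, v] - c * G y [u, v])" if "y \<in> U" for y
    unfolding bilinear_def
    by (intro conjI allI linearI; simp add: bilinear_simps[OF symmetric_form_fieldD(1)[OF B that]]
        bilinear_simps[OF symmetric_form_fieldD(1)[OF G that]] algebra_simps)
  then show ?thesis
    using assms Ck_on_diff_cmult[OF U, of 2] unfolding symmetric_form_field_def by simp
qed

lemma sum_of_products_is_little_o:
  fixes h v :: "'i \<Rightarrow> real \<Rightarrow> real"
  assumes h: "\<And>k. k \<in> I \<Longrightarrow> h k 0 = 0" "\<And>k. k \<in> I \<Longrightarrow> (h k has_real_derivative 0) (at 0)"
    and v: "\<And>k. k \<in> I \<Longrightarrow> v k 0 = 0" "\<And>k. k \<in> I \<Longrightarrow> (v k has_real_derivative d k) (at 0)"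
  shows "((\<lambda>t. (\<Sum>k\<in>I. h k t * v k t) / t\<^sup>2) \<longlongrightarrow> 0) (at 0)"
proof -
  have "((\<lambda>t. \<Sum>k\<in>I. (h k t / t) * (v k t / t)) \<longlongrightarrow> (\<Sum>k\<in>I. 0 * d k)) (at 0)"
    using h v by (intro tendsto_sum tendsto_mult) (simp_all add: has_field_derivative_iff)
  then show ?thesis
    by (simp add: sum_divide_distrib power2_eq_square)
qed

text \<open>The bound \<open>partial_eigenvalue_sum_le\<close> is applied along a curve \<open>y\<close> through \<open>y0\<close> to test vectors \<open>w k\<close> that
start at \<open>E k\<close>. It says that \<open>f (y t)\<close> is at most \<open>\<Sum>k. T k (w k, w k) + lam k\<close> up to \<open>o(t\<^sup>2)\<close>, with equality at
\<open>t = 0\<close>; here \<open>T k = B - lam k * G\<close>. The two claims are the first and second order conditions for this minimum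
of the difference.

The velocity of \<open>w k\<close> is \<open>q k - p k\<close>. The part \<open>- p k\<close> makes the motion covariant: with \<open>q k = 0\<close> the second
derivative of \<open>T k (w k, w k)\<close> would be the second covariant derivative of \<open>B\<close>. The part \<open>q k\<close> tilts
\<open>E k\<close> towards the eigenvectors above the gap and contributes \<open>4 * N [E k, q k, u] + 2 * T k (q k, q k)\<close>, whose
minimum over \<open>q k\<close> in the span of these is the negative gradient term of the claim.\<close>

theorem subtrace_support_in_coordinates:
  fixes G B N :: "'e::euclidean_space \<Rightarrow> 'e list \<Rightarrow> real" and E :: "nat \<Rightarrow> 'e"
  assumes U: "open U" "y0 \<in> U" and G: "metric_field U G" and B: "symmetric_form_field U B"
    and m: "1 \<le> m" "m \<le> DIM('e)"
    and W: "open W" "y0 \<in> W" and f: "Ck_on 2 W f"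
    and le: "\<And>y F \<mu>. y \<in> U \<inter> W \<Longrightarrow>
        eigenframe (\<lambda>u v. G y [u, v]) (\<lambda>u v. B y [u, v]) DIM('e) F \<mu> \<Longrightarrow> f y \<le> (\<Sum>j=1..m. \<mu> j)"
    and E: "eigenframe (\<lambda>u v. G y0 [u, v]) (\<lambda>u v. B y0 [u, v]) DIM('e) E lam"
    and eq: "f y0 = (\<Sum>k=1..m. lam k)"
    and D: "m \<le> D" "\<And>r. r \<in> {D+1..DIM('e)} \<Longrightarrow> lam m < lam r"
    and N: "\<And>y a b w. y \<in> U \<Longrightarrow> N y [a, b, w] = local_nabla G B y [a, b, w]"
  shows "frechet_derivative f (at y0) u = (\<Sum>k=1..m. N y0 [E k, E k, u])" (is ?first)
    and "frechet_derivative (\<lambda>y. frechet_derivative f (at y) u) (at y0) u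
        - frechet_derivative f (at y0) (levi_civita_coeff G y0 u u)
      \<le> (\<Sum>k=1..m. local_nabla G N y0 [E k, E k, u, u])
        - 2 * (\<Sum>k=1..m. \<Sum>r=D+1..DIM('e). (N y0 [E k, E r, u])\<^sup>2 / (lam r - lam k))" (is ?second)
proof -
  let ?I = "{1..m}" and ?R = "{D+1..DIM('e)}"
  have GS: "symmetric_form_field U G" using G by (simp add: metric_field_def)
  note Gb = symmetric_form_fieldD(1)[OF GS] and Bb = symmetric_form_fieldD(1)[OF B]
  have ortho: "G y0 [E j, E k] = (if j = k then 1 else 0)" if "j \<in> {1..DIM('e)}" "k \<in> {1..DIM('e)}" for j k
    using E that by (simp add: eigenframe_def orthonormal_family_def)
  have eig: "B y0 [E j, v] = lam j * G y0 [E j, v]" if "j \<in> {1..DIM('e)}" for j v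
    using E that by (simp add: eigenframe_def)
  have mono: "lam j \<le> lam k" if "j \<in> {1..DIM('e)}" "k \<in> {1..DIM('e)}" "j \<le> k" for j k
    using E that by (auto simp: eigenframe_def mono_on_def)
  have I: "k \<in> {1..DIM('e)}" if "k \<in> ?I" for k using that m by auto
  have R: "r \<in> {1..DIM('e)}" "r \<notin> ?I" if "r \<in> ?R" for r using that D(1) by auto
  have gap: "lam k < lam r" if "k \<in> ?I" "r \<in> ?R" for k r
    using mono[of k m] D(2)[OF that(2)] that(1) m by fastforce
  define z where "z = levi_civita_coeff G y0 u u"
  define y where "y t = y0 + t *\<^sub>R u - (t\<^sup>2 / 2) *\<^sub>R z" for t
  define p where "p k = levi_civita_coeff G y0 u (E k)" for k
  (* c k r minimises 4 * N [E k, E r, u] * c + 2 * (lam r - lam k) * c^2 *)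
  define c where "c k r = - N y0 [E k, E r, u] / (lam r - lam k)" for k r
  define q where "q k = (\<Sum>r\<in>?R. c k r *\<^sub>R E r)" for k
  define w where "w k t = E k + t *\<^sub>R (q k - p k)" for k t
  (* As the metric is parallel, T k and B have the same covariant derivatives; subtracting lam k times
     the metric puts E k into the kernel at y0. *)
  define T where "T k y as = B y as - lam k * G y as" for k y as
  have TS: "symmetric_form_field U (T k)" for k
    unfolding T_def[abs_def] by (rule symmetric_form_field_diff_cmult[OF U(1) B GS])
  note Tb = symmetric_form_fieldD(1)[OF TS U(2)]
  have NT: "N y [a, b, v] = local_nabla G (T k) y [a, b, v]" if "y \<in> U" for y a b v k
    using local_nabla_minus_metric[OF G U(1) that B, of "T k" "lam k"] N[OF that] by (simp add: T_def)
  have ker: "T k y0 [E k, v] = 0" "T k y0 [v, E k] = 0" if "k \<in> ?I" for k v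
    using eig[OF I[OF that]] symmetric_form_fieldD(2)[OF TS U(2), of k v "E k"] by (simp_all add: T_def)
  have [simp]: "y 0 = y0" "w k 0 = E k" for k by (simp_all add: y_def w_def)

  (* h k l = o(t), since parallel motion preserves products to first order and q k is orthogonal to all E l
     with l <= m; and v k l = O(t). So the terms h * h and h * v of the eigenvalue bound are o(t^2). *)
  define h where "h k l t = G (y t) [w k t, w l t] - (if k = l then 1 else 0)" for k l t
  define v where "v k l t = B (y t) [w k t, w l t] - (if k = l then lam k else 0)" for k l t
  have h0: "h k l 0 = 0" and v0: "v k l 0 = 0" if "k \<in> ?I" "l \<in> ?I" for k l
    using that I by (simp_all add: h_def v_def ortho eig)
  have h': "(h k l has_real_derivative 0) (at 0)" if "k \<in> ?I" "l \<in> ?I" for k l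
  proof -
    have qE: "G y0 [q k, E l] = 0" if "l \<in> ?I" for k l
    proof -
      have "G y0 [E r, E l] = 0" if "r \<in> ?R" for r
        using ortho[OF R(1)[OF that] I[OF \<open>l \<in> ?I\<close>]] R(2)[OF that] \<open>l \<in> ?I\<close> by auto
      then show ?thesis
        unfolding q_def using bilinear_sum_left[OF Gb[OF U(2)], of "c k" E ?R "E l"] by simp
    qed
    have "form_deriv G y0 u (E k) (E l) + G y0 [q k - p k, E l] + G y0 [E k, q l - p l]
        = G y0 [q k, E l] + G y0 [q l, E k]"
      unfolding levi_civita_coeff(3)[OF G U] p_def[symmetric]
      by (simp add: bilinear_simps[OF Gb[OF U(2)]] symmetric_form_fieldD(2)[OF GS U(2), of "E k" "q l"])
    then have "((\<lambda>t. G (y t) [w k t, w l t]) has_real_derivative 0) (at 0)"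
      using jet2_imp_DERIV[OF jet2_form_along_curve[OF U GS y_def, of "E k" "q k - p k" "E l" "q l - p l"]]
        qE that by (simp add: w_def)
    then show ?thesis unfolding h_def by (auto intro!: derivative_eq_intros)
  qed
  define v1 where "v1 k l = form_deriv B y0 u (E k) (E l) + B y0 [q k - p k, E l] + B y0 [E k, q l - p l]" for k l
  have v': "(v k l has_real_derivative v1 k l) (at 0)" for k l
    using jet2_imp_DERIV[OF jet2_form_along_curve[OF U B y_def, of "E k" "q k - p k" "E l" "q l - p l"]]
    unfolding v_def v1_def w_def by (auto intro!: derivative_eq_intros)

  obtain K where K: "\<forall>\<^sub>F y in nhds y0. \<forall>v. B y [v, v] \<le> K * G y [v, v]"
  proof (rule rayleigh_quotient_bounded_near[of "\<lambda>y u v. G y [u, v]" y0 "\<lambda>y u v. B y [u, v]"])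
    have inU: "\<forall>\<^sub>F y in nhds y0. y \<in> U" using U by (rule eventually_nhds_in_open)
    show "\<forall>\<^sub>F y in nhds y0. bilinear (\<lambda>u v. G y [u, v])" "\<forall>\<^sub>F y in nhds y0. bilinear (\<lambda>u v. B y [u, v])"
      using inU by (auto elim!: eventually_mono intro: Gb Bb)
    show "inner_form (\<lambda>u v. G y0 [u, v])" using G U by (simp add: metric_field_def)
  qed (use symmetric_form_field_tendsto(1)[OF GS U(2)] symmetric_form_field_tendsto(1)[OF B U(2)] in auto)

  define Rem where "Rem t = K * (\<Sum>k\<in>?I. \<Sum>l\<in>?I. (h k l t)\<^sup>2) - (\<Sum>k\<in>?I. \<Sum>l\<in>?I. h k l t * v k l t)" for t
  define \<phi> where "\<phi> t = (\<Sum>k\<in>?I. T k (y t) [w k t, w k t]) - f (y t) + (\<Sum>k\<in>?I. lam k)" for t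
  have Rem: "((\<lambda>t. Rem t / t\<^sup>2) \<longlongrightarrow> 0) (at 0)"
  proof -
    have "((\<lambda>t. (\<Sum>(k,l)\<in>?I \<times> ?I. h k l t * h k l t) / t\<^sup>2) \<longlongrightarrow> 0) (at 0)"
      using sum_of_products_is_little_o[of "?I \<times> ?I" "\<lambda>(k,l). h k l" "\<lambda>(k,l). h k l" "\<lambda>_. 0"] h0 h'
      by (auto simp: case_prod_unfold)
    moreover have "((\<lambda>t. (\<Sum>(k,l)\<in>?I \<times> ?I. h k l t * v k l t) / t\<^sup>2) \<longlongrightarrow> 0) (at 0)"
      using sum_of_products_is_little_o[of "?I \<times> ?I" "\<lambda>(k,l). h k l" "\<lambda>(k,l). v k l" "\<lambda>(k,l). v1 k l"] h0 h' v0 v'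
      by (auto simp: case_prod_unfold)
    ultimately have "((\<lambda>t. K * ((\<Sum>(k,l)\<in>?I \<times> ?I. h k l t * h k l t) / t\<^sup>2)
        - (\<Sum>(k,l)\<in>?I \<times> ?I. h k l t * v k l t) / t\<^sup>2) \<longlongrightarrow> K * 0 - 0) (at 0)"
      by (intro tendsto_intros)
    then show ?thesis
      by (simp add: Rem_def sum.cartesian_product power2_eq_square diff_divide_distrib)
  qed

  have "(y \<longlongrightarrow> y0) (at 0)"
    unfolding y_def by (auto intro!: tendsto_eq_intros)
  then have near: "\<forall>\<^sub>F t in at 0. P (y t)" if "\<forall>\<^sub>F x in nhds y0. P x" for P
    using that by (rule eventually_compose_filterlim[rotated])
  have small: "\<forall>\<^sub>F t in at 0. \<forall>k\<in>?I. \<forall>l\<in>?I. \<bar>h k l t\<bar> \<le> 1 / m"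
  proof (intro eventually_ball_finite ballI finite_atLeastAtMost)
    fix k l assume kl: "k \<in> ?I" "l \<in> ?I"
    have "(h k l \<longlongrightarrow> 0) (at 0)"
      using DERIV_isCont[OF h'[OF kl]] h0[OF kl] by (simp add: isCont_def)
    then have "\<forall>\<^sub>F t in at 0. dist (h k l t) 0 < 1 / m"
      using m(1) by (intro tendstoD) auto
    then show "\<forall>\<^sub>F t in at 0. \<bar>h k l t\<bar> \<le> 1 / m" by eventually_elim simp
  qed
  have nonneg: "\<forall>\<^sub>F t in at 0. 0 \<le> \<phi> t + Rem t"
    using near[OF K] near[OF eventually_nhds_in_open[OF U]] near[OF eventually_nhds_in_open[OF W]] small
  proof eventually_elim
    case (elim t)
    have Gt: "inner_form (\<lambda>u v. G (y t) [u, v])" using G elim(2) by (simp add: metric_field_def)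
    obtain F \<mu> where F: "eigenframe (\<lambda>u v. G (y t) [u, v]) (\<lambda>u v. B (y t) [u, v]) DIM('e) F \<mu>"
      using eigenframe_exists[OF Gt Bb[OF elim(2)] symmetric_form_fieldD(2)[OF B elim(2)]] by blast
    have "\<mu> m \<le> K"
    proof -
      have "G (y t) [F m, F m] = 1" "B (y t) [F m, F m] = \<mu> m * G (y t) [F m, F m]"
        using F m unfolding eigenframe_def orthonormal_family_def by auto
      then show ?thesis using elim(1)[rule_format, of "F m"] by simp
    qed
    have "f (y t) \<le> (\<Sum>j=1..m. \<mu> j)" using le[OF _ F] elim by simp
    also have "\<dots> \<le> (\<Sum>k\<in>?I. B (y t) [w k t, w k t])
        - (\<Sum>k\<in>?I. \<Sum>l\<in>?I. h k l t * B (y t) [w k t, w l t]) + K * (\<Sum>k\<in>?I. \<Sum>l\<in>?I. (h k l t)\<^sup>2)"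
      by (rule partial_eigenvalue_sum_le[OF Gt Bb[OF elim(2)] F m, where h="\<lambda>k l. h k l t"])
        (use elim(4) \<open>\<mu> m \<le> K\<close> in \<open>auto simp: h_def\<close>)
    also have "(\<Sum>k\<in>?I. \<Sum>l\<in>?I. h k l t * B (y t) [w k t, w l t])
        = (\<Sum>k\<in>?I. \<Sum>l\<in>?I. h k l t * v k l t + (if k = l then lam k * h k k t else 0))"
      by (intro sum.cong refl) (simp add: v_def algebra_simps)
    also have "\<dots> = (\<Sum>k\<in>?I. \<Sum>l\<in>?I. h k l t * v k l t) + (\<Sum>k\<in>?I. lam k * h k k t)"
      by (simp add: sum.distrib)
    also have "(\<Sum>k\<in>?I. B (y t) [w k t, w k t])
        = (\<Sum>k\<in>?I. T k (y t) [w k t, w k t]) + (\<Sum>k\<in>?I. lam k * h k k t) + (\<Sum>k\<in>?I. lam k)"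
      unfolding sum.distrib[symmetric] by (intro sum.cong refl) (simp add: T_def h_def algebra_simps)
    finally show ?case by (simp add: \<phi>_def Rem_def)
  qed

  let ?DDf = "frechet_derivative (\<lambda>y. frechet_derivative f (at y) u) (at y0) u - frechet_derivative f (at y0) z"
  let ?a = "(\<Sum>k\<in>?I. N y0 [E k, E k, u]) - frechet_derivative f (at y0) u"
  let ?b = "(\<Sum>k\<in>?I. local_nabla G N y0 [E k, E k, u, u]
      - 2 * (\<Sum>r\<in>?R. (N y0 [E k, E r, u])\<^sup>2 / (lam r - lam k))) - ?DDf"
  (* the value of the second derivative of the k-th summand after completing the square *)
  have jetT: "jet2 (\<lambda>t. T k (y t) [w k t, w k t]) (N y0 [E k, E k, u])
      (local_nabla G N y0 [E k, E k, u, u] - 2 * (\<Sum>r\<in>?R. (N y0 [E k, E r, u])\<^sup>2 / (lam r - lam k)))"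
    if k: "k \<in> ?I" for k
  proof -
    note ker = ker[OF k]
    have Dsym: "form_deriv (T k) y0 x a b = form_deriv (T k) y0 x b a" for x a b
      by (rule form_deriv_linear(3)[OF TS U])
    have N2: "local_nabla G N y0 [E k, E k, u, u] =
        frechet_derivative (\<lambda>y. form_deriv (T k) y u (E k) (E k)) (at y0) u
        - form_deriv (T k) y0 z (E k) (E k) - 4 * form_deriv (T k) y0 u (E k) (p k) + 2 * T k y0 [p k, p k]"
      unfolding z_def by (rule second_local_nabla_at_kernel[OF G U TS ker(1) NT p_def])
    have N1: "N y0 [E k, x, u] = form_deriv (T k) y0 u (E k) x - T k y0 [p k, x]" for x
      unfolding NT[OF U(2), of _ _ _ k] local_nabla_2 by (simp add: ker p_def)
    have Nlin: "N y0 [E k, q k, u] = (\<Sum>r\<in>?R. c k r * N y0 [E k, E r, u])"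
      unfolding q_def N[OF U(2)]
      using bilinear_sum_right[OF local_nabla_bilinear[OF G U B], of "E k" "c k" E ?R u] by simp
    have Tqq: "T k y0 [q k, q k] = (\<Sum>r\<in>?R. (c k r)\<^sup>2 * (lam r - lam k))"
    proof -
      have TE: "T k y0 [E r, E s] = (if r = s then lam r - lam k else 0)" if "r \<in> ?R" "s \<in> ?R" for r s
        using R(1)[OF that(1)] R(1)[OF that(2)] by (simp add: T_def ortho eig)
      have "T k y0 [q k, q k] = (\<Sum>r\<in>?R. c k r * T k y0 [E r, q k])"
        using bilinear_sum_left[OF Tb, of k "c k" E ?R "q k"] by (simp only: q_def[symmetric] real_scaleR_def)
      also have "\<dots> = (\<Sum>r\<in>?R. c k r * (\<Sum>s\<in>?R. c k s * T k y0 [E r, E s]))"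
        using bilinear_sum_right[OF Tb, of k _ "c k" E ?R] by (simp only: q_def[symmetric] real_scaleR_def)
      also have "\<dots> = (\<Sum>r\<in>?R. c k r * (\<Sum>s\<in>?R. if r = s then c k r * (lam r - lam k) else 0))"
        by (intro sum.cong refl arg_cong2[of _ _ _ _ times]) (simp add: TE)
      also have "\<dots> = (\<Sum>r\<in>?R. (c k r)\<^sup>2 * (lam r - lam k))"
        by (simp add: power2_eq_square mult.assoc)
      finally show ?thesis .
    qed
    have Tsym: "T k y0 [q k, p k] = T k y0 [p k, q k]"
      by (rule symmetric_form_fieldD(2)[OF TS U(2)])
    have completed: "4 * N y0 [E k, q k, u] + 2 * T k y0 [q k, q k]
        = - 2 * (\<Sum>r\<in>?R. (N y0 [E k, E r, u])\<^sup>2 / (lam r - lam k))"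
    proof -
      have "4 * (c k r * N y0 [E k, E r, u]) + 2 * ((c k r)\<^sup>2 * (lam r - lam k))
          = - 2 * ((N y0 [E k, E r, u])\<^sup>2 / (lam r - lam k))" if "r \<in> ?R" for r
      proof -
        have "4 * (- n / d * n) + 2 * ((- n / d)\<^sup>2 * d) = - 2 * (n\<^sup>2 / d)" if "d > 0" for n d :: real
          using that by (simp add: field_simps power2_eq_square)
        from this[of "lam r - lam k"] show ?thesis using gap[OF k that] by (simp add: c_def)
      qed
      then show ?thesis
        unfolding Nlin Tqq sum_distrib_left sum.distrib[symmetric] by (intro sum.cong refl) simp
    qed
    have first: "form_deriv (T k) y0 u (E k) (E k) + T k y0 [q k - p k, E k] + T k y0 [E k, q k - p k]
        = N y0 [E k, E k, u]"
      unfolding N1 by (simp add: ker)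
    have second: "frechet_derivative (\<lambda>y. form_deriv (T k) y u (E k) (E k)) (at y0) u - form_deriv (T k) y0 z (E k) (E k)
        + 2 * form_deriv (T k) y0 u (q k - p k) (E k) + 2 * form_deriv (T k) y0 u (E k) (q k - p k)
        + 2 * T k y0 [q k - p k, q k - p k]
      = local_nabla G N y0 [E k, E k, u, u] + (4 * N y0 [E k, q k, u] + 2 * T k y0 [q k, q k])"
      unfolding N2 N1 Dsym[of u "q k - p k"]
      by (simp add: bilinear_simps[OF Tb] bilinear_simps[OF form_deriv_linear(2)[OF TS U]] Tsym algebra_simps)
    from jet2_form_along_curve[OF U TS[of k] y_def, of "E k" "q k - p k" "E k" "q k - p k"]
    show ?thesis
      unfolding first second completed w_def[symmetric] by simp
  qed
  have "jet2 \<phi> (?a + 0) (?b + 0)"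
    unfolding \<phi>_def y_def
    by (intro jet2_add jet2_const jet2_diff jet2_sum jet2_along_curve[OF W f] jetT[unfolded y_def])
  then have jet: "jet2 \<phi> ?a ?b" by simp
  have "\<phi> 0 = 0"
    by (simp add: \<phi>_def eq ker)
  note concl = jet2_nonneg_minimum[OF jet this Rem nonneg]
  from concl(1) show ?first by simp
  from concl(2) show ?second
    by (simp add: z_def[symmetric] sum_subtractf sum_distrib_left)
qed

section \<open>Eigenvalue lists and traces\<close>

lemma sorted_count_list_unique:
  fixes xs :: "'a::linorder list"
  assumes "sorted xs" "sorted ys" "\<And>x. count_list xs x = count_list ys x"
  shows "xs = ys"
proof -
  have "mset xs = mset ys"
    using assms(3) by (intro multiset_eqI) (simp add: count_mset count_list_eq_length_filter)
  then show ?thesis using assms(1,2) by (metis properties_for_sort)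
qed

lemma count_list_map_upt: "count_list (map \<mu> [1..<Suc n]) x = card {j \<in> {1..n}. \<mu> j = x}"
proof (induction n)
  case (Suc n)
  have "{j \<in> {1..Suc n}. \<mu> j = x} = (if \<mu> (Suc n) = x then insert (Suc n) {j \<in> {1..n}. \<mu> j = x} else {j \<in> {1..n}. \<mu> j = x})"
    by (auto simp: le_Suc_eq)
  then show ?case using Suc by simp
qed simp

text \<open>The eigenspace dimensions determine the multiset of entries, and sortedness determines their order.\<close>

lemma eigenvalue_list_eqI:
  assumes "mono_on {1..n} \<mu>" "\<And>x. dim {v \<in> V. F v = x *\<^sub>R v} = card {j \<in> {1..n}. \<mu> j = x}"
  shows "eigenvalue_list V F = map \<mu> [1..<Suc n]"
  unfolding eigenvalue_list_def
proof (rule the_equality)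
  have s: "sorted (map \<mu> [1..<Suc n])"
    using assms(1) by (auto simp: sorted_iff_nth_mono mono_on_def simp del: upt_Suc)
  then show "sorted (map \<mu> [1..<Suc n]) \<and> (\<forall>x. count_list (map \<mu> [1..<Suc n]) x = dim {v \<in> V. F v = x *\<^sub>R v})"
    unfolding count_list_map_upt assms(2) by simp
  show "xs = map \<mu> [1..<Suc n]" if "sorted xs \<and> (\<forall>x. count_list xs x = dim {v \<in> V. F v = x *\<^sub>R v})" for xs
    using that s by (intro sorted_count_list_unique) (simp_all only: count_list_map_upt assms(2))
qed

text \<open>The form \<open>h\<close> need only agree with a bilinear form on \<open>V\<close>: a metric tensor is bilinear just on the tangent
space, whereas its coordinate expression extends to all families of coordinate vectors.\<close>

lemma trace_on_eq_sum:
  fixes h' b' :: "'v::real_vector \<Rightarrow> 'v \<Rightarrow> real"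
  assumes h: "\<And>u v. u \<in> V \<Longrightarrow> v \<in> V \<Longrightarrow> h [u, v] = h' u v" "bilinear h'" "\<And>u v. h' u v = h' v u"
    and b: "\<And>u v. b [u, v] = b' u v" "bilinear b'"
    and e: "orthonormal_basis h V m e"
  shows "trace_on h V b = (\<Sum>k=1..m. b [e k, e k])"
  unfolding trace_on_def
proof (rule the_equality)
  have on: "orthonormal_family h' {1..d} f" "span (f ` {1..d}) = V" if "orthonormal_basis h V d f" for d f
  proof -
    show s: "span (f ` {1..d}) = V" using that by (simp add: orthonormal_basis_def)
    have "f k \<in> V" if "k \<in> {1..d}" for k
      using span_base[of "f k" "f ` {1..d}"] that unfolding s by simp
    then show "orthonormal_family h' {1..d} f"
      using that h(1) by (simp add: orthonormal_basis_def orthonormal_family_def)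
  qed
  show "\<forall>d f. orthonormal_basis h V d f \<longrightarrow> (\<Sum>k=1..m. b [e k, e k]) = (\<Sum>k=1..d. b [f k, f k])"
    unfolding b(1) using on e
    by (auto intro!: sum_diagonal_orthonormal_basis[OF h(2,3) b(2)])
  then show "t = (\<Sum>k=1..m. b [e k, e k])"
    if "\<forall>d f. orthonormal_basis h V d f \<longrightarrow> t = (\<Sum>k=1..d. b [f k, f k])" for t
    using that e by blast
qed

section \<open>A chart of a Riemannian manifold\<close>

lemma tcomp_simps [simp]:
  "tcomp (u + v) c = tcomp u c + tcomp v c" "tcomp (a *\<^sub>R u) c = a *\<^sub>R tcomp u c" "tcomp 0 c = 0"
  by (simp_all add: plus_tvec_def scaleR_tvec_def zero_tvec_def)

lemma tvec_eqI: "(\<And>c. tcomp u c = tcomp v c) \<Longrightarrow> u = v"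
  by (rule tvec.expand) auto

locale riemannian_chart =
  fixes A :: "('p::{t2_space, second_countable_topology}, 'e::euclidean_space) chart set"
    and g :: "('p, 'e) tensor" and c :: "('p, 'e) chart"
  assumes riem: "riemannian_manifold A g" and cA: "c \<in> A"
begin

definition coord_range :: "'e set" where "coord_range = snd c ` fst c"

lemma manifold: "smooth_manifold A"
  using riem by (simp add: riemannian_manifold_def)

lemma chart_inverse:
  assumes "c' \<in> A"
  shows "open (fst c')" "open (snd c' ` fst c')" "continuous_on (snd c' ` fst c') (chart_inv c')"
    "\<And>p. p \<in> fst c' \<Longrightarrow> chart_inv c' (snd c' p) = p"
  using manifold assms unfolding smooth_manifold_def homeomorphism_def by blast+

lemma open_coord_range: "open coord_range"
  using chart_inverse[OF cA] by (simp add: coord_range_def)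

lemma in_coord_range:
  assumes "y \<in> coord_range"
  shows "chart_inv c y \<in> fst c" "snd c (chart_inv c y) = y"
  using assms chart_inverse(4)[OF cA] by (auto simp: coord_range_def)

lemma open_chart_image:
  assumes "c' \<in> A" "open W"
  shows "open (snd c' ` (fst c' \<inter> W))"
proof -
  have "snd c' ` (fst c' \<inter> W) = chart_inv c' -` W \<inter> snd c' ` fst c'"
    using chart_inverse(4)[OF assms(1)] by force
  then show ?thesis
    using chart_inverse(2,3)[OF assms(1)] assms(2) continuous_on_open_vimage by metis
qed

lemma transition_has_derivative:
  assumes "c1 \<in> charts_at A p" "c2 \<in> charts_at A p"
  shows "((snd c2 \<circ> chart_inv c1) has_derivative transition_deriv c1 c2 p) (at (snd c1 p))"
proof -
  have "smooth_on (snd c1 ` (fst c1 \<inter> fst c2)) (snd c2 \<circ> chart_inv c1)"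
    using manifold assms by (auto simp: smooth_manifold_def charts_at_def)
  then have "Ck_on (Suc 0) (snd c1 ` (fst c1 \<inter> fst c2)) (snd c2 \<circ> chart_inv c1)"
    unfolding smooth_on_def by blast
  moreover have "snd c1 p \<in> snd c1 ` (fst c1 \<inter> fst c2)" using assms by (auto simp: charts_at_def)
  ultimately show ?thesis
    unfolding transition_deriv_def frechet_derivative_works[symmetric] Ck_on.simps by blast
qed

text \<open>The chain rule for the transition maps, which compose on the open image of the triple overlap.\<close>

lemma transition_deriv_cocycle:
  assumes "c1 \<in> charts_at A p" "c2 \<in> charts_at A p" "c3 \<in> charts_at A p"
  shows "transition_deriv c2 c3 p (transition_deriv c1 c2 p a) = transition_deriv c1 c3 p a"
proof -
  let ?O = "snd c1 ` (fst c1 \<inter> (fst c1 \<inter> fst c2 \<inter> fst c3))"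
  have A: "c1 \<in> A" "c2 \<in> A" "c3 \<in> A" and p: "p \<in> fst c1" "p \<in> fst c2" "p \<in> fst c3"
    using assms by (auto simp: charts_at_def)
  have "((snd c3 \<circ> chart_inv c2) has_derivative transition_deriv c2 c3 p) (at ((snd c2 \<circ> chart_inv c1) (snd c1 p)))"
    using transition_has_derivative[OF assms(2,3)] chart_inverse(4)[OF A(1) p(1)] by simp
  from has_derivative_compose[OF transition_has_derivative[OF assms(1,2)] this]
  have "((\<lambda>x. (snd c3 \<circ> chart_inv c2) ((snd c2 \<circ> chart_inv c1) x)) has_derivative
      (\<lambda>a. transition_deriv c2 c3 p (transition_deriv c1 c2 p a))) (at (snd c1 p))" .
  moreover have "open ?O"
    by (intro open_chart_image A open_Int chart_inverse)
  moreover have "snd c1 p \<in> ?O" using p by auto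
  moreover have "(snd c3 \<circ> chart_inv c2) ((snd c2 \<circ> chart_inv c1) x) = (snd c3 \<circ> chart_inv c1) x" if "x \<in> ?O" for x
    using that chart_inverse(4)[OF A(1)] chart_inverse(4)[OF A(2)] by auto
  ultimately have "((snd c3 \<circ> chart_inv c1) has_derivative
      (\<lambda>a. transition_deriv c2 c3 p (transition_deriv c1 c2 p a))) (at (snd c1 p))"
    by (rule has_derivative_transform_within_open)
  from has_derivative_unique[OF this transition_has_derivative[OF assms(1,3)]]
  show ?thesis by metis
qed

lemma transition_deriv_self:
  assumes "p \<in> fst c"
  shows "transition_deriv c c p a = a"
proof -
  have "((snd c \<circ> chart_inv c) has_derivative (\<lambda>a. a)) (at (snd c p))"
    by (rule has_derivative_transform_within_open[OF has_derivative_ident open_coord_range])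
      (use assms in_coord_range in \<open>auto simp: coord_range_def\<close>)
  moreover have "c \<in> charts_at A p" using cA assms by (simp add: charts_at_def)
  ultimately show ?thesis
    using has_derivative_unique transition_has_derivative[of c p c] by metis
qed

context
  fixes p assumes p: "p \<in> fst c"
begin

lemma c_at: "c \<in> charts_at A p"
  using cA p by (simp add: charts_at_def)

lemma tcomp_coord_vec: "tcomp (coord_vec A c p a) c = a"
  using c_at transition_deriv_self[OF p] by (simp add: coord_vec_def)

text \<open>With \<open>tcomp_coord_vec\<close> and \<open>coord_vec_tcomp\<close>, coordinate vectors in \<open>c\<close> are isomorphic to tangent vectors.\<close>

lemma coord_vec_tangent: "coord_vec A c p a \<in> tangent_space A p"
  using transition_deriv_cocycle[OF c_at] by (auto simp: tangent_space_def coord_vec_def)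

lemma coord_vec_tcomp:
  assumes "v \<in> tangent_space A p"
  shows "coord_vec A c p (tcomp v c) = v"
proof (rule tvec_eqI)
  fix c'
  have "c' \<in> charts_at A p \<Longrightarrow> tcomp v c' = transition_deriv c c' p (tcomp v c)"
    and "c' \<notin> charts_at A p \<Longrightarrow> tcomp v c' = 0"
    using assms c_at unfolding tangent_space_def by blast+
  then show "tcomp (coord_vec A c p (tcomp v c)) c' = tcomp v c'"
    by (simp add: coord_vec_def)
qed

lemma coord_vec_linear: "linear (coord_vec A c p)"
proof (rule linearI)
  have l: "linear (transition_deriv c c' p)" if "c' \<in> charts_at A p" for c'
    using transition_has_derivative[OF c_at that] has_derivative_linear by blast
  show "coord_vec A c p (a + b) = coord_vec A c p a + coord_vec A c p b" for a b
    by (rule tvec_eqI) (simp add: coord_vec_def linear_add[OF l])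
  show "coord_vec A c p (r *\<^sub>R a) = r *\<^sub>R coord_vec A c p a" for r a
    by (rule tvec_eqI) (simp add: coord_vec_def linear_scale[OF l])
qed

lemma scaleR_tangent: "v \<in> tangent_space A p \<Longrightarrow> r *\<^sub>R v \<in> tangent_space A p"
  using coord_vec_tangent[of "r *\<^sub>R tcomp v c"] coord_vec_tcomp[of v] by (simp add: linear_scale[OF coord_vec_linear])

lemma tensor_in_chart:
  "u \<in> tangent_space A p \<Longrightarrow> v \<in> tangent_space A p \<Longrightarrow>
    T p [u, v] = local_rep A c T (snd c p) [tcomp u c, tcomp v c]"
  using chart_inverse(4)[OF cA p] by (simp add: local_rep_def coord_vec_tcomp)

end

lemma symmetric_form_field_local_rep:
  assumes "symmetric_tensor_field A T"
  shows "symmetric_form_field coord_range (local_rep A c T)"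
  unfolding symmetric_form_field_def
proof (intro conjI ballI allI)
  have sm: "smooth_tensor_field A 2 T"
    and sym: "\<And>p u v. u \<in> tangent_space A p \<Longrightarrow> v \<in> tangent_space A p \<Longrightarrow> T p [u, v] = T p [v, u]"
    using assms by (auto simp: symmetric_tensor_field_def)
  show "Ck_on 2 coord_range (\<lambda>y. local_rep A c T y [u, v])" for u v
    using sm cA by (simp add: smooth_tensor_field_def smooth_on_def coord_range_def)
  fix y assume y: "y \<in> coord_range"
  define p where "p = chart_inv c y"
  have p: "p \<in> fst c" using in_coord_range[OF y] by (simp add: p_def)
  note cv = coord_vec_tangent[OF p]
  show s: "local_rep A c T y [u, v] = local_rep A c T y [v, u]" for u v
    using sym[OF cv cv] by (simp add: local_rep_def p_def)
  have lin: "T p [r *\<^sub>R a + b, v] = r * T p [a, v] + T p [b, v]"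
    if "a \<in> tangent_space A p" "b \<in> tangent_space A p" "v \<in> tangent_space A p" for a b v r
    using sm[unfolded smooth_tensor_field_def, THEN conjunct1, rule_format, of "[a, v]" p 0 a b r] that by simp
  have l: "linear (\<lambda>u. local_rep A c T y [u, v])" for v
  proof (rule linearI)
    have *: "local_rep A c T y [r *\<^sub>R a + b, v] = r * local_rep A c T y [a, v] + local_rep A c T y [b, v]" for r a b
      using lin[OF cv cv cv]
      by (simp add: local_rep_def p_def[symmetric] linear_add[OF coord_vec_linear[OF p]] linear_scale[OF coord_vec_linear[OF p]])
    show "local_rep A c T y [a + b, v] = local_rep A c T y [a, v] + local_rep A c T y [b, v]" for a b
      using *[of 1] by simp
    have "local_rep A c T y [0, v] = 0" using *[of 1 0 0] by simp
    then show "local_rep A c T y [r *\<^sub>R a, v] = r *\<^sub>R local_rep A c T y [a, v]" for a r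
      using *[of r a 0] by simp
  qed
  then show "bilinear (\<lambda>u v. local_rep A c T y [u, v])"
    unfolding bilinear_def using l by (simp add: s[of _ "v" for v])
qed

abbreviation G where "G \<equiv> local_rep A c g"

lemma metric_field_G: "metric_field coord_range G"
  unfolding metric_field_def inner_form_def
proof (intro conjI ballI allI impI)
  have "symmetric_tensor_field A g" using riem by (simp add: riemannian_manifold_def)
  then show GS: "symmetric_form_field coord_range G" by (rule symmetric_form_field_local_rep)
  fix y assume y: "y \<in> coord_range"
  show "bilinear (\<lambda>u v. G y [u, v])" "G y [u, v] = G y [v, u]" for u v
    by (rule symmetric_form_fieldD[OF GS y])+
  fix v :: 'e assume "v \<noteq> 0"
  then have "coord_vec A c (chart_inv c y) v \<noteq> 0"
    using tcomp_coord_vec[OF in_coord_range(1)[OF y], of v] by auto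
  then show "0 < G y [v, v]"
    using riem coord_vec_tangent[OF in_coord_range(1)[OF y]] by (simp add: riemannian_manifold_def local_rep_def)
qed

text \<open>The endomorphism is defined by a unique representation property. Once existence (Riesz) and uniqueness
(definiteness of the metric) are known, its eigenvectors are those of one coordinate
form relative to the other.\<close>

lemma sharp_eq_scaleR_iff:
  assumes \<alpha>: "symmetric_tensor_field A \<alpha>" and p: "p \<in> fst c" and u: "u \<in> tangent_space A p"
  shows "sharp A g \<alpha> p u = x *\<^sub>R u \<longleftrightarrow>
    (\<forall>b. local_rep A c \<alpha> (snd c p) [tcomp u c, b] = x * G (snd c p) [tcomp u c, b])"
proof -
  let ?y = "snd c p" and ?B = "local_rep A c \<alpha>" and ?V = "tangent_space A p"
  have y: "?y \<in> coord_range" using p by (simp add: coord_range_def)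
  note B = symmetric_form_field_local_rep[OF \<alpha>]
  have H: "inner_form (\<lambda>a b. G ?y [a, b])" using metric_field_G y by (simp add: metric_field_def)
  have char: "(w \<in> ?V \<and> (\<forall>v\<in>?V. g p [w, v] = \<alpha> p [u, v])) \<longleftrightarrow>
      w \<in> ?V \<and> (\<forall>b. G ?y [tcomp w c, b] = ?B ?y [tcomp u c, b])" for w
    using tensor_in_chart[OF p _ coord_vec_tangent[OF p]] tensor_in_chart[OF p] u
    by (metis tcomp_coord_vec[OF p] coord_vec_tangent[OF p])
  have Gl: "G ?y [r *\<^sub>R a, b] = r * G ?y [a, b]" for r a b
    using H bilinear_lmul[of "\<lambda>a b. G ?y [a, b]" r a b] by (simp add: inner_form_def)
  have lin: "linear (\<lambda>b. ?B ?y [tcomp u c, b])"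
    using symmetric_form_fieldD(1)[OF B y] by (simp add: bilinear_def)
  obtain F :: "nat \<Rightarrow> 'e" where
    "\<And>l w. linear l \<Longrightarrow> G ?y [\<Sum>j=1..DIM('e). l (F j) *\<^sub>R F j, w] = l w"
    using riesz_representation[OF H] by blast
  from this[OF lin] obtain a where a: "\<And>b. G ?y [a, b] = ?B ?y [tcomp u c, b]"
    by blast
  have unique: "w = coord_vec A c p a" if "w \<in> ?V \<and> (\<forall>b. G ?y [tcomp w c, b] = ?B ?y [tcomp u c, b])" for w
  proof -
    have "tcomp w c = a" by (rule inner_form_eqI[OF H]) (use that a in simp)
    then show ?thesis using coord_vec_tcomp[OF p, of w] that by simp
  qed
  have sharp: "sharp A g \<alpha> p u = coord_vec A c p a"
    unfolding sharp_def char
    by (rule the_equality[OF _ unique]) (simp_all add: coord_vec_tangent[OF p] tcomp_coord_vec[OF p] a)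
  show ?thesis
  proof
    assume "sharp A g \<alpha> p u = x *\<^sub>R u"
    then have au: "a = x *\<^sub>R tcomp u c"
      using sharp tcomp_coord_vec[OF p, of a] by simp
    show "\<forall>b. ?B ?y [tcomp u c, b] = x * G ?y [tcomp u c, b]"
      unfolding a[symmetric] au Gl by simp
  next
    assume "\<forall>b. ?B ?y [tcomp u c, b] = x * G ?y [tcomp u c, b]"
    then have "x *\<^sub>R u = coord_vec A c p a"
      using scaleR_tangent[OF p u] by (intro unique) (simp add: Gl)
    then show "sharp A g \<alpha> p u = x *\<^sub>R u" using sharp by simp
  qed
qed

lemma bilinear_tcomp:
  assumes "bilinear B" shows "bilinear (\<lambda>u v. B (tcomp u c) (tcomp v c))"
  unfolding bilinear_def by (intro conjI allI linearI) (simp_all add: bilinear_simps[OF assms])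

text \<open>The \<open>x\<close>-eigenspace is spanned by the frame vectors with \<open>\<mu> j = x\<close>: pairing an eigenvector with a frame vector of
another eigenvalue gives a coefficient that is multiplied by both eigenvalues, hence vanishes.\<close>

lemma subtrace_eq_eigenframe_sum:
  assumes \<alpha>: "symmetric_tensor_field A \<alpha>" and p: "p \<in> fst c" and m: "m \<le> DIM('e)"
    and F: "eigenframe (\<lambda>u v. G (snd c p) [u, v]) (\<lambda>u v. local_rep A c \<alpha> (snd c p) [u, v]) DIM('e) F \<mu>"
  shows "subtrace A g \<alpha> m p = (\<Sum>k=1..m. \<mu> k)"
proof -
  let ?y = "snd c p" and ?B = "local_rep A c \<alpha>" and ?V = "tangent_space A p" and ?J = "{1..DIM('e)}"
  have y: "?y \<in> coord_range" using p by (simp add: coord_range_def)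
  have Bsym: "?B ?y [a, b] = ?B ?y [b, a]" for a b
    by (rule symmetric_form_fieldD(2)[OF symmetric_form_field_local_rep[OF \<alpha>] y])
  have H: "inner_form (\<lambda>a b. G ?y [a, b])" using metric_field_G y by (simp add: metric_field_def)
  then have bil: "bilinear (\<lambda>a b. G ?y [a, b])" and Gsym: "\<And>a b. G ?y [a, b] = G ?y [b, a]"
    by (auto simp: inner_form_def)
  have on: "orthonormal_family (\<lambda>a b. G ?y [a, b]) ?J F"
    and eig: "\<And>j v. j \<in> ?J \<Longrightarrow> ?B ?y [F j, v] = \<mu> j * G ?y [F j, v]" and mono: "mono_on ?J \<mu>"
    using F by (auto simp: eigenframe_def)
  have "dim {v \<in> ?V. sharp A g \<alpha> p v = x *\<^sub>R v} = card {j \<in> ?J. \<mu> j = x}" for x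
  proof -
    let ?E = "{v \<in> ?V. sharp A g \<alpha> p v = x *\<^sub>R v}" and ?K = "{j \<in> ?J. \<mu> j = x}"
    define f where "f j = coord_vec A c p (F j)" for j
    have fK: "orthonormal_family (\<lambda>u v. G ?y [tcomp u c, tcomp v c]) ?K f"
      using on by (simp add: orthonormal_family_def f_def tcomp_coord_vec[OF p])
    show ?thesis
    proof (rule dim_unique[of "f ` ?K"])
      show "f ` ?K \<subseteq> ?E"
        by (auto simp: f_def sharp_eq_scaleR_iff[OF \<alpha> p] coord_vec_tangent[OF p] tcomp_coord_vec[OF p] eig)
      show "independent (f ` ?K)"
        by (rule orthonormal_family_independent[OF bilinear_tcomp[OF bil] _ fK]) simp
      show "card (f ` ?K) = card ?K"
        by (rule card_image[OF orthonormal_family_inj[OF fK]])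
      show "?E \<subseteq> span (f ` ?K)"
      proof
        fix v assume v: "v \<in> ?E"
        define a where "a = tcomp v c"
        have Ba: "?B ?y [a, b] = x * G ?y [a, b]" for b
          using v sharp_eq_scaleR_iff[OF \<alpha> p, of v x] by (simp add: a_def)
        have zero: "G ?y [a, F j] = 0" if "j \<in> ?J" "\<mu> j \<noteq> x" for j
          using eig[OF that(1), of a] Ba[of "F j"] that(2) Bsym[of a "F j"] Gsym[of a "F j"] by simp
        have "a = (\<Sum>j\<in>?J. G ?y [a, F j] *\<^sub>R F j)"
          by (rule orthonormal_expansion[OF bil _ on]) (use orthonormal_family_span[OF bil on] in auto)
        also have "\<dots> = (\<Sum>j\<in>?K. G ?y [a, F j] *\<^sub>R F j)"
          by (rule sum.mono_neutral_right) (auto simp: zero)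
        finally have "v = coord_vec A c p (\<Sum>j\<in>?K. G ?y [a, F j] *\<^sub>R F j)"
          using coord_vec_tcomp[OF p, of v] v by (simp add: a_def)
        also have "\<dots> = (\<Sum>j\<in>?K. G ?y [a, F j] *\<^sub>R f j)"
          by (simp add: f_def linear_sum[OF coord_vec_linear[OF p]] linear_scale[OF coord_vec_linear[OF p]])
        finally show "v \<in> span (f ` ?K)"
          by (simp only:) (intro span_sum span_scale span_base imageI)
      qed
    qed
  qed
  from eigenvalue_list_eqI[OF mono this]
  have "eigenvalue A g \<alpha> p k = \<mu> k" if "k \<in> {1..m}" for k
    using that m nth_map_upt[of "k - 1" "Suc DIM('e)" 1 \<mu>] by (auto simp: eigenvalue_def simp del: upt_Suc)
  then show ?thesis by (simp add: subtrace_def)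
qed

lemma local_rep_nabla:
  assumes "y \<in> coord_range"
  shows "local_rep A c (nabla A g c T) y as = local_nabla G (local_rep A c T) y as"
  using in_coord_range[OF assms] tcomp_coord_vec[OF in_coord_range(1)[OF assms]]
  by (simp add: local_rep_def[of A c "nabla A g c T"] nabla_def o_def)

end

lemma local_nabla_function:
  "local_nabla G F y [w] = frechet_derivative (\<lambda>x. F x []) (at y) w"
  by (simp add: local_nabla_def Let_def)

lemma local_nabla_1:
  "local_nabla G F y [a, w] = frechet_derivative (\<lambda>x. F x [a]) (at y) w - F y [levi_civita_coeff G y w a]"
  by (simp add: local_nabla_def Let_def)

section \<open>The support inequality on a manifold\<close>

theorem lemma3p2:
  fixes A :: "('p::{t2_space, second_countable_topology}, 'e::euclidean_space) chart set"
    and g \<alpha> :: "('p, 'e) tensor"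
    and m :: nat and x0 :: 'p and \<xi> :: "'p \<Rightarrow> real"
    and e :: "nat \<Rightarrow> ('p, 'e) tvec" and lam :: "nat \<Rightarrow> real" and D :: nat
    and c :: "('p, 'e) chart" and i :: nat
  assumes "riemannian_manifold A g"
    and "symmetric_tensor_field A \<alpha>"
    and "1 \<le> m" and "m \<le> DIM('e)"
    and "lower_support A (subtrace A g \<alpha> m) \<xi> x0"
    and "orthonormal_basis (g x0) (tangent_space A x0) DIM('e) e"
    and "\<forall>k\<in>{1..DIM('e)}. sharp A g \<alpha> x0 (e k) = lam k *\<^sub>R e k"
    and "mono_on {1..DIM('e)} lam"
    and "D = Max {k \<in> {1..DIM('e)}. lam k = lam m}"
    and "c \<in> charts_at A x0"
    and "i \<in> {1..DIM('e)}"
  shows "nabla A g c (\<lambda>p _. \<xi> p) x0 [e i]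
           = trace_on (g x0) (span (e ` {1..m})) (\<lambda>vs. nabla A g c \<alpha> x0 (vs @ [e i])) \<and>
         trace_on (g x0) (span (e ` {1..m})) (\<lambda>vs. nabla A g c \<alpha> x0 (vs @ [e i]))
           = (\<Sum>k=1..m. nabla A g c \<alpha> x0 [e k, e k, e i]) \<and>
         nabla A g c (nabla A g c (\<lambda>p _. \<xi> p)) x0 [e i, e i]
           \<le> (\<Sum>k=1..m. nabla A g c (nabla A g c \<alpha>) x0 [e k, e k, e i, e i])
             - 2 * (\<Sum>k=1..m. \<Sum>r=D+1..DIM('e).
                 (nabla A g c \<alpha> x0 [e k, e r, e i])\<^sup>2 / (lam r - lam k))"
proof -
  interpret riemannian_chart A g c
    using assms(1,10) by unfold_locales (auto simp: charts_at_def)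
  have x0: "x0 \<in> fst c" using assms(10) by (simp add: charts_at_def)
  define y0 where "y0 = snd c x0"
  have y0: "y0 \<in> coord_range" using x0 by (simp add: coord_range_def y0_def)
  have inv_y0: "chart_inv c y0 = x0" using chart_inverse(4)[OF cA x0] by (simp add: y0_def)
  let ?B = "local_rep A c \<alpha>" and ?J = "{1..DIM('e)}"
  note B = symmetric_form_field_local_rep[OF assms(2)]
  have bil: "bilinear (\<lambda>u v. G y0 [u, v])" and Gsym: "\<And>u v. G y0 [u, v] = G y0 [v, u]"
    using metric_field_G y0 by (auto simp: metric_field_def inner_form_def)
  define E where "E k = tcomp (e k) c" for k
  define f where "f y = \<xi> (chart_inv c y)" for y
  define N where "N = local_rep A c (nabla A g c \<alpha>)"
  have N: "N y as = local_nabla G ?B y as" if "y \<in> coord_range" for y as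
    unfolding N_def by (rule local_rep_nabla[OF that])
  have nabla1: "nabla A g c \<alpha> x0 vs = N y0 (map (\<lambda>v. tcomp v c) vs)" for vs
    unfolding N[OF y0] by (simp add: nabla_def y0_def)
  have nabla2: "nabla A g c (nabla A g c \<alpha>) x0 vs = local_nabla G N y0 (map (\<lambda>v. tcomp v c) vs)" for vs
    by (simp add: nabla_def N_def y0_def)
  have et: "e k \<in> tangent_space A x0" if "k \<in> ?J" for k
    using span_base[of "e k" "e ` ?J"] assms(6) that by (simp add: orthonormal_basis_def)
  have eigE: "eigenframe (\<lambda>u v. G y0 [u, v]) (\<lambda>u v. ?B y0 [u, v]) DIM('e) E lam"
    unfolding eigenframe_def orthonormal_family_def
  proof (intro conjI ballI allI assms(8))
    show "G y0 [E j, E k] = (if j = k then 1 else 0)" if "j \<in> ?J" "k \<in> ?J" for j k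
      using assms(6) tensor_in_chart[OF x0 et[OF that(1)] et[OF that(2)], of g] that
      by (simp add: orthonormal_basis_def E_def y0_def)
    show "?B y0 [E j, v] = lam j * G y0 [E j, v]" if "j \<in> ?J" for j v
      using sharp_eq_scaleR_iff[OF assms(2) x0 et[OF that], of "lam j"] assms(7) that
      by (simp add: E_def y0_def)
  qed
  obtain W where W: "open W" "x0 \<in> W" "smooth_function_on A W \<xi>" "\<And>x. x \<in> W \<Longrightarrow> \<xi> x \<le> subtrace A g \<alpha> m x"
    and \<xi>0: "\<xi> x0 = subtrace A g \<alpha> m x0"
    using assms(5) unfolding lower_support_def by blast
  define W' where "W' = snd c ` (fst c \<inter> W)"
  have W': "open W'" "y0 \<in> W'"
    using open_chart_image[OF cA W(1)] x0 W(2) by (auto simp: W'_def y0_def)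
  have f: "Ck_on 2 W' f"
    using W(3) cA by (simp add: smooth_function_on_def smooth_on_def W'_def f_def[abs_def] o_def)
  have le: "f y \<le> (\<Sum>j=1..m. \<mu> j)"
    if y: "y \<in> coord_range \<inter> W'" and F: "eigenframe (\<lambda>u v. G y [u, v]) (\<lambda>u v. ?B y [u, v]) DIM('e) F \<mu>" for y F \<mu>
  proof -
    obtain q where q: "q \<in> fst c" "q \<in> W" "y = snd c q" using y by (auto simp: W'_def)
    then show ?thesis
      using W(4)[OF q(2)] subtrace_eq_eigenframe_sum[OF assms(2) q(1) assms(4)] F
        chart_inverse(4)[OF cA q(1)] by (simp add: f_def)
  qed
  have f0: "f y0 = (\<Sum>k=1..m. lam k)"
    using \<xi>0 subtrace_eq_eigenframe_sum[OF assms(2) x0 assms(4)] eigE inv_y0 by (simp add: f_def y0_def)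
  have fin: "finite {k \<in> ?J. lam k = lam m}" by simp
  have mD: "m \<le> D" unfolding assms(9) by (rule Max_ge[OF fin]) (use assms(3,4) in auto)
  have gap: "lam m < lam r" if "r \<in> {D+1..DIM('e)}" for r
  proof -
    have "lam m \<le> lam r" using assms(3,4,8) that mD by (auto simp: mono_on_def)
    moreover have "lam r \<noteq> lam m"
      using Max_ge[OF fin, of r] that mD assms(3) unfolding assms(9)[symmetric] by auto
    ultimately show ?thesis by simp
  qed
  note support = subtrace_support_in_coordinates[OF open_coord_range y0 metric_field_G B assms(3,4) W' f _ eigE f0 mD gap N]
  have gradient: "frechet_derivative f (at y0) (E i) = (\<Sum>k=1..m. N y0 [E k, E k, E i])"
    by (rule support(1)) (rule le)
  have hessian: "frechet_derivative (\<lambda>y. frechet_derivative f (at y) (E i)) (at y0) (E i)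
        - frechet_derivative f (at y0) (levi_civita_coeff G y0 (E i) (E i))
      \<le> (\<Sum>k=1..m. local_nabla G N y0 [E k, E k, E i, E i])
        - 2 * (\<Sum>k=1..m. \<Sum>r=D+1..DIM('e). (N y0 [E k, E r, E i])\<^sup>2 / (lam r - lam k))"
    by (rule support(2)) (rule le)

  have \<xi>1: "local_rep A c (nabla A g c (\<lambda>p _. \<xi> p)) y [a] = frechet_derivative f (at y) a" if "y \<in> coord_range" for y a
    unfolding local_rep_nabla[OF that] local_nabla_function by (simp add: local_rep_def f_def[abs_def])
  have first: "nabla A g c (\<lambda>p _. \<xi> p) x0 [e i] = frechet_derivative f (at y0) (E i)"
    by (simp add: nabla_def local_nabla_function local_rep_def f_def[abs_def] y0_def E_def)
  have second: "nabla A g c (nabla A g c (\<lambda>p _. \<xi> p)) x0 [e i, e i]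
      = frechet_derivative (\<lambda>y. frechet_derivative f (at y) (E i)) (at y0) (E i)
        - frechet_derivative f (at y0) (levi_civita_coeff G y0 (E i) (E i))"
  proof -
    have "(\<lambda>y. frechet_derivative f (at y) (E i)) differentiable (at y0)"
      using Ck_on_2D(2)[OF f W'(2)] .
    from frechet_derivative_transform_within_open[OF this open_coord_range y0, of "\<lambda>y. local_rep A c (nabla A g c (\<lambda>p _. \<xi> p)) y [E i]"]
    show ?thesis
      by (simp add: nabla_def[of A g c "nabla A g c _"] local_nabla_1 \<xi>1 y0 flip: y0_def E_def)
  qed

  have trace: "trace_on (g x0) (span (e ` {1..m})) (\<lambda>vs. nabla A g c \<alpha> x0 (vs @ [e i]))
      = (\<Sum>k=1..m. nabla A g c \<alpha> x0 ([e k, e k] @ [e i]))"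
  proof (rule trace_on_eq_sum[where h' = "\<lambda>u v. G y0 [tcomp u c, tcomp v c]"])
    have "span (e ` {1..m}) \<subseteq> tangent_space A x0"
      using assms(4,6) unfolding orthonormal_basis_def by (metis atLeastatMost_subset_iff image_mono le_refl span_mono)
    then show "g x0 [u, v] = G y0 [tcomp u c, tcomp v c]"
      if "u \<in> span (e ` {1..m})" "v \<in> span (e ` {1..m})" for u v
      using tensor_in_chart[OF x0, of u v g] that by (auto simp: y0_def)
    show "bilinear (\<lambda>u v. G y0 [tcomp u c, tcomp v c])" by (rule bilinear_tcomp[OF bil])
    show "G y0 [tcomp u c, tcomp v c] = G y0 [tcomp v c, tcomp u c]" for u v by (rule Gsym)
    show "nabla A g c \<alpha> x0 ([u, v] @ [e i]) = local_nabla G ?B y0 [tcomp u c, tcomp v c, E i]" for u v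
      by (simp add: nabla1 N[OF y0] E_def)
    show "bilinear (\<lambda>u v. local_nabla G ?B y0 [tcomp u c, tcomp v c, E i])"
      by (rule bilinear_tcomp[OF local_nabla_bilinear[OF metric_field_G open_coord_range y0 B]])
    show "orthonormal_basis (g x0) (span (e ` {1..m})) m e"
      using assms(4,6) by (auto simp: orthonormal_basis_def)
  qed
  show ?thesis
    unfolding trace first second using gradient hessian by (simp add: nabla1 nabla2 E_def)
qed

end
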